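(* Let $\mathcal{A}$ be a unital $C^*$-algebra, let $a\in\mathcal{A}$ be a positive and invertible element and let $x,y\in\mathcal{A}$. Then: 1) $x\perp_{BJ}^{v_a}y$ if and only if for each $\theta\in[0,2\pi)$ there exists $\varphi\in\mathcal{S}_a(\mathcal{A})$ such that $$|\varphi(ax)|=v_a(x)\quad\text{and}\quad \mathrm{Re}\big(e^{i\theta}\,\overline{\varphi(ax)}\,\varphi(ay)\big)\ge 0.$$ 2) $x\perp_{BJ}^{a}y$ if and only if for each $\theta\in[0,2\pi)$ there exists $\varphi\in\mathcal{S}_a(\mathcal{A})$ such that $$\varphi(x^*ax)=\|x\|_a^2\quad\text{and}\quad \mathrm{Re}\big(e^{i\theta}\varphi(x^*ay)\big)\ge 0.$$
   Context: $\mathcal{S}_a(\mathcal{A})=\{\varphi\in\mathcal{A}' : \varphi\ge 0,\ \varphi(a)=1\}$, where $\mathcal{A}'$ is the topological dual of $\mathcal{A}$. For $x\in\mathcal{A}$, $\|x\|_a=\sup\{\sqrt{\varphi(x^*ax)} : \varphi\in\mathcal{S}_a(\mathcal{A})\}$ and $v_a(x)=\sup\{|\varphi(ax)| : \varphi\in\mathcal{S}_a(\mathcal{A})\}$. One writes $x\perp_{BJ}^{a}y$ ($a$-Birkhoff-James orthogonality) if $\|x+\xi y\|_a\ge\|x\|_a$ for all $\xi\in\mathbb{C}$, and $x\perp_{BJ}^{v_a}y$ ($a$-numerical radius Birkhoff-James orthogonality) if $v_a(x+\xi y)\ge v_a(x)$ for all $\xi\in\mathbb{C}$. *)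

theory Defs
  imports "HOL-Analysis.Analysis"
begin

class complex_banach_algebra_1 = real_normed_algebra_1 + banach +
  fixes scaleC :: "complex \<Rightarrow> 'a \<Rightarrow> 'a" (infixr \<open>*\<^sub>C\<close> 75)
  assumes scaleC_add_right: "c *\<^sub>C (x + y) = c *\<^sub>C x + c *\<^sub>C y"
    and scaleC_add_left: "(c + d) *\<^sub>C x = c *\<^sub>C x + d *\<^sub>C x"
    and scaleC_scaleC: "c *\<^sub>C (d *\<^sub>C x) = (c * d) *\<^sub>C x"
    and scaleC_of_real: "complex_of_real r *\<^sub>C x = r *\<^sub>R x"
    and mult_scaleC_left: "(c *\<^sub>C x) * y = c *\<^sub>C (x * y)"
    and mult_scaleC_right: "x * (c *\<^sub>C y) = c *\<^sub>C (x * y)"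
    and norm_scaleC: "norm (c *\<^sub>C x) = cmod c * norm x"

text \<open>
  Unital C*-algebras. The zero algebra is excluded, since \<open>norm 1 = 1\<close> is an axiom of the
  superclass \<^class>\<open>real_normed_algebra_1\<close>; in every nonzero unital C*-algebra it holds
  automatically.
\<close>

class unital_cstar_algebra = complex_banach_algebra_1 +
  fixes star :: "'a \<Rightarrow> 'a"
  assumes star_add: "star (x + y) = star x + star y"
    and star_scaleC: "star (c *\<^sub>C x) = cnj c *\<^sub>C star x"
    and star_mult: "star (x * y) = star y * star x"
    and star_star: "star (star x) = x"
    and cstar_identity: "norm (star x * x) = (norm x)\<^sup>2"

text \<open>Two-sided invertibility; \<open>a dvd 1\<close> would only give a right inverse.\<close>

definition alg_invertible :: "'a::ring_1 \<Rightarrow> bool" where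
  "alg_invertible a \<longleftrightarrow> (\<exists>b. a * b = 1 \<and> b * a = 1)"

definition spectrum :: "'a::complex_banach_algebra_1 \<Rightarrow> complex set" where
  "spectrum a = {z. \<not> alg_invertible (a - z *\<^sub>C 1)}"

definition positive_element :: "'a::unital_cstar_algebra \<Rightarrow> bool" where
  "positive_element a \<longleftrightarrow> star a = a \<and> spectrum a \<subseteq> \<real>\<^sub>\<ge>\<^sub>0"

definition topological_dual :: "('a::complex_banach_algebra_1 \<Rightarrow> complex) set" where
  "topological_dual = {\<phi>. bounded_linear \<phi> \<and> (\<forall>c x. \<phi> (c *\<^sub>C x) = c * \<phi> x)}"

definition positive_functional :: "('a::unital_cstar_algebra \<Rightarrow> complex) \<Rightarrow> bool" where
  "positive_functional \<phi> \<longleftrightarrow> (\<forall>x. \<phi> (star x * x) \<in> \<real>\<^sub>\<ge>\<^sub>0)"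

definition a_states :: "'a::unital_cstar_algebra \<Rightarrow> ('a \<Rightarrow> complex) set" where
  "a_states a = {\<phi> \<in> topological_dual. positive_functional \<phi> \<and> \<phi> a = 1}"

text \<open>
  For positive \<open>a\<close> and positive \<open>\<phi>\<close> the value \<open>\<phi> (star x * a * x)\<close> is a nonnegative real,
  so \<^const>\<open>Re\<close> loses nothing. If moreover \<open>a\<close> is invertible, the suprema below range over
  nonempty bounded sets of reals.
\<close>

definition a_norm :: "'a::unital_cstar_algebra \<Rightarrow> 'a \<Rightarrow> real" where
  "a_norm a x = (SUP \<phi>\<in>a_states a. sqrt (Re (\<phi> (star x * a * x))))"

definition a_numerical_radius :: "'a::unital_cstar_algebra \<Rightarrow> 'a \<Rightarrow> real" where
  "a_numerical_radius a x = (SUP \<phi>\<in>a_states a. cmod (\<phi> (a * x)))"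

definition a_BJ_orthogonal :: "'a::unital_cstar_algebra \<Rightarrow> 'a \<Rightarrow> 'a \<Rightarrow> bool" where
  "a_BJ_orthogonal a x y \<longleftrightarrow> (\<forall>\<xi>. a_norm a (x + \<xi> *\<^sub>C y) \<ge> a_norm a x)"

definition a_numerical_radius_BJ_orthogonal :: "'a::unital_cstar_algebra \<Rightarrow> 'a \<Rightarrow> 'a \<Rightarrow> bool" where
  "a_numerical_radius_BJ_orthogonal a x y \<longleftrightarrow>
    (\<forall>\<xi>. a_numerical_radius a (x + \<xi> *\<^sub>C y) \<ge> a_numerical_radius a x)"

end

theory Submission
  imports Defs
begin

text \<open>
  Write \<open>K\<close> for the set of \<open>a\<close>-states. For \<open>\<xi> = r e\<^sup>i\<^sup>\<theta>\<close> and
  \<open>\<phi>\<close> in \<open>K\<close> both \<open>\<bar>\<phi>(a(x + \<xi>y))\<bar>\<^sup>2\<close> and \<open>\<phi>((x + \<xi>y)\<^sup>* a (x + \<xi>y))\<close> have the form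
  \<open>f \<phi> + r g \<phi> + r\<^sup>2 h \<phi>\<close> with \<open>h \<ge> 0\<close>, where \<open>g \<phi>\<close> is twice the real part in the statement.
  A \<open>\<phi>\<close> that maximises \<open>f\<close> and has \<open>g \<phi> \<ge> 0\<close> therefore shows that the perturbed supremum
  is at least \<open>sup f\<close>. Conversely, if every perturbed supremum is at least \<open>sup f\<close>, then \<open>K\<close>
  contains, for each small \<open>r\<close>, a point that almost maximises \<open>f\<close> and at which \<open>g\<close> is almost
  nonnegative; compactness of \<open>K\<close> yields an exact one (\<open>compact_directional_maximizer\<close>).

  It remains to see that \<open>K\<close> is nonempty and weak-* compact. Compactness is Tychonoff's theorem
  once \<open>K\<close> is uniformly bounded (\<open>compact_a_states\<close>). Since a positive functional \<open>\<phi>\<close>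
  satisfies \<open>\<bar>\<phi>(z)\<bar> \<le> 2 \<phi>(1) \<parallel>z\<parallel>\<close>, boundedness follows from \<open>a \<ge> \<epsilon>1\<close> for some
  \<open>\<epsilon> > 0\<close> (\<open>positive_invertible_bounded_below\<close>). Nonemptiness follows from the same inequality
  and the existence of a state (\<open>exists_state\<close>), which the Hahn--Banach theorem provides once all
  \<open>z\<^sup>*z\<close> are known to be positive (\<open>nonneg_star_mult_self\<close>).

  The order theory that this needs is developed without Gelfand theory. A self-adjoint \<open>h\<close> is
  called \<open>nonneg\<close> if \<open>\<parallel>t1 - h\<parallel> \<le> t\<close> for some \<open>t \<ge> 0\<close>; such elements form a cone by the
  triangle inequality. The binomial series for \<open>\<surd>(1 - w)\<close> converges for \<open>\<parallel>w\<parallel> \<le> 1\<close>, so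
  every \<open>nonneg\<close> element is the square of one commuting with everything that commutes with
  it; together with the C*-identity this square root takes the place of spectral calculus.
\<close>

section \<open>The binomial series of the square root\<close>

text \<open>
  \<open>sqrt_coeff n\<close> is the coefficient of \<open>w\<^sup>n\<close> in the expansion of \<open>\<surd>(1 - w)\<close>. All
  coefficients after the first are nonpositive and all partial sums are nonnegative, so the
  series converges absolutely on the closed unit ball.
\<close>

definition sqrt_coeff :: "nat \<Rightarrow> real" where
  "sqrt_coeff n = (-1) ^ n * ((1/2) gchoose n)"

lemma sqrt_coeff_0 [simp]: "sqrt_coeff 0 = 1"
  by (simp add: sqrt_coeff_def)

lemma sqrt_coeff_Suc_nonpos: "sqrt_coeff (Suc n) \<le> 0"
proof -
  have "sqrt_coeff (Suc n) = (- 1/2) * (pochhammer (1/2) n / fact (Suc n))"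
    unfolding sqrt_coeff_def gbinomial_pochhammer
    by (simp add: pochhammer_rec flip: power_add mult.assoc)
  moreover have "0 \<le> pochhammer (1/2::real) n / fact (Suc n)"
    by (intro divide_nonneg_nonneg pochhammer_nonneg) auto
  ultimately show ?thesis by linarith
qed

lemma sum_sqrt_coeff_nonneg: "0 \<le> (\<Sum>k\<le>n. sqrt_coeff k)"
proof -
  have "(\<Sum>k\<le>n. sqrt_coeff k) = (-1) ^ n * ((1/2 - 1) gchoose n)"
    unfolding sqrt_coeff_def gbinomial_sum_lower_neg [symmetric] by (simp add: mult.commute)
  also have "\<dots> = pochhammer (1/2) n / fact n"
    unfolding gbinomial_pochhammer by (simp flip: power_add mult.assoc)
  also have "\<dots> \<ge> 0"
    by (intro divide_nonneg_nonneg pochhammer_nonneg) auto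
  finally show ?thesis .
qed

lemma sum_abs_sqrt_coeff_le: "(\<Sum>k<n. \<bar>sqrt_coeff (Suc k)\<bar>) \<le> 1"
proof -
  have "(\<Sum>k<n. \<bar>sqrt_coeff (Suc k)\<bar>) = - (\<Sum>k<n. sqrt_coeff (Suc k))"
    by (simp add: sqrt_coeff_Suc_nonpos flip: sum_negf)
  also have "\<dots> = 1 - (\<Sum>k\<le>n. sqrt_coeff k)"
    by (simp add: sum.atMost_shift)
  finally show ?thesis using sum_sqrt_coeff_nonneg [of n] by simp
qed

lemma sqrt_coeff_convolution:
  "(\<Sum>i\<le>n. sqrt_coeff i * sqrt_coeff (n - i)) = (if n = 0 then 1 else if n = 1 then - 1 else 0)"
proof -
  have "(\<Sum>i\<le>n. sqrt_coeff i * sqrt_coeff (n - i)) =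
      (\<Sum>i\<le>n. (-1) ^ n * (((1/2) gchoose i) * ((1/2) gchoose (n - i))))"
  proof (intro sum.cong refl)
    fix i assume "i \<in> {..n}"
    then have "(-1::real) ^ n = (-1) ^ i * (-1) ^ (n - i)"
      by (simp flip: power_add)
    then show "sqrt_coeff i * sqrt_coeff (n - i) =
        (-1) ^ n * (((1/2) gchoose i) * ((1/2) gchoose (n - i)))"
      by (simp add: sqrt_coeff_def)
  qed
  also have "\<dots> = (-1) ^ n * (1 gchoose n)"
    using gbinomial_Vandermonde [of "1/2::real" "1/2" n]
    by (simp add: atLeast0AtMost flip: sum_distrib_left)
  also have "(1 gchoose n :: real) = of_nat (1 choose n)"
    using binomial_gbinomial [of 1 n, where 'a = real] by simp
  also have "(-1) ^ n * real (1 choose n) = (if n = 0 then 1 else if n = 1 then - 1 else 0)"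
    by (auto simp: binomial_eq_0)
  finally show ?thesis .
qed

text \<open>
  The square root of \<open>1 - w\<close> given by the binomial series; meaningful for \<open>norm w \<le> 1\<close>.
\<close>

definition sqrt_one_minus :: "'a::{real_normed_algebra_1,banach} \<Rightarrow> 'a" where
  "sqrt_one_minus w = (\<Sum>n. sqrt_coeff n *\<^sub>R w ^ n)"

lemma summable_sqrt_series:
  fixes w :: "'a::{real_normed_algebra_1,banach}"
  assumes "norm w \<le> 1"
  shows "summable (\<lambda>n. norm (sqrt_coeff n *\<^sub>R w ^ n))"
proof -
  have w: "norm (w ^ n) \<le> 1" for n
    using norm_power_ineq [of w n] power_le_one [OF norm_ge_zero assms] by (rule order_trans)
  have "summable (\<lambda>n. \<bar>sqrt_coeff n\<bar>)"
    by (subst summable_Suc_iff [symmetric])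
       (intro summableI_nonneg_bounded [where x = 1] sum_abs_sqrt_coeff_le, simp)
  then show ?thesis
    by (rule summable_comparison_test' [where N = 0]) (simp add: mult_left_le w)
qed

lemma sqrt_one_minus_squared:
  fixes w :: "'a::{real_normed_algebra_1,banach}"
  assumes "norm w \<le> 1"
  shows "sqrt_one_minus w * sqrt_one_minus w = 1 - w"
proof -
  have "(\<Sum>i\<le>n. sqrt_coeff i *\<^sub>R w ^ i * sqrt_coeff (n - i) *\<^sub>R w ^ (n - i))
      = (if n = 0 then 1 else if n = 1 then - 1 else 0) *\<^sub>R w ^ n" for n
    unfolding sqrt_coeff_convolution [symmetric] scaleR_sum_left
    by (intro sum.cong refl) (simp flip: power_add)
  then have "(\<lambda>n. (if n = 0 then 1 else if n = 1 then - 1 else 0) *\<^sub>R w ^ n) sums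
      (sqrt_one_minus w * sqrt_one_minus w)"
    using Cauchy_product_sums [OF summable_sqrt_series summable_sqrt_series, OF assms assms]
    by (simp add: sqrt_one_minus_def)
  moreover have "(\<lambda>n. (if n = 0 then 1 else if n = 1 then - 1 else 0) *\<^sub>R w ^ n) sums
      (\<Sum>n\<in>{0,1}. (if n = 0 then 1 else if n = 1 then - 1 else 0) *\<^sub>R w ^ n)"
    by (intro sums_finite) auto
  ultimately show ?thesis
    using sums_unique2 by fastforce
qed

lemma norm_one_minus_sqrt_one_minus:
  fixes w :: "'a::{real_normed_algebra_1,banach}"
  assumes "norm w \<le> 1"
  shows "norm (1 - sqrt_one_minus w) \<le> 1"
proof -
  let ?t = "\<lambda>n. sqrt_coeff (Suc n) *\<^sub>R w ^ Suc n"
  have sm: "summable (\<lambda>n. norm (?t n))"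
    using summable_sqrt_series [OF assms] by (subst summable_Suc_iff)
  have "sqrt_one_minus w = 1 + (\<Sum>n. ?t n)"
    unfolding sqrt_one_minus_def
    using suminf_split_head [OF summable_norm_cancel [OF summable_sqrt_series [OF assms]]]
    by (simp add: algebra_simps)
  then have "norm (1 - sqrt_one_minus w) = norm (\<Sum>n. ?t n)"
    by simp
  also have "\<dots> \<le> (\<Sum>n. norm (?t n))"
    by (rule summable_norm [OF sm])
  also have "\<dots> \<le> 1"
  proof (rule suminf_le_const [OF sm])
    fix n
    have "norm (w ^ Suc k) \<le> 1" for k
      using norm_power_ineq [of w "Suc k"] power_le_one [OF norm_ge_zero assms] by (rule order_trans)
    then have "(\<Sum>k<n. norm (?t k)) \<le> (\<Sum>k<n. \<bar>sqrt_coeff (Suc k)\<bar>)"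
      by (intro sum_mono) (auto intro: mult_left_le simp del: power_Suc)
    then show "(\<Sum>k<n. norm (?t k)) \<le> 1"
      using sum_abs_sqrt_coeff_le [of n] by linarith
  qed
  finally show ?thesis .
qed

lemma sqrt_one_minus_commute:
  fixes w z :: "'a::{real_normed_algebra_1,banach}"
  assumes "norm w \<le> 1" and "z * w = w * z"
  shows "z * sqrt_one_minus w = sqrt_one_minus w * z"
proof -
  have sm: "summable (\<lambda>n. sqrt_coeff n *\<^sub>R w ^ n)"
    by (rule summable_norm_cancel [OF summable_sqrt_series [OF assms(1)]])
  have "z * w ^ n = w ^ n * z" for n
    using assms(2) by (rule power_commuting_commutes [symmetric, OF sym])
  then show ?thesis
    unfolding sqrt_one_minus_def suminf_mult [OF sm, symmetric] suminf_mult2 [OF sm] by simp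
qed

section \<open>Scalars, adjoints and self-adjoint parts\<close>

lemma scaleC_one [simp]: "1 *\<^sub>C x = x" for x :: "'a::complex_banach_algebra_1"
  using scaleC_of_real [of 1 x] by simp

lemma scaleC_minus_one [simp]: "(- 1) *\<^sub>C x = - x" for x :: "'a::complex_banach_algebra_1"
  using scaleC_of_real [of "- 1" x] by simp

lemma scaleC_minus_right [simp]: "c *\<^sub>C (- x) = - (c *\<^sub>C x)"
  for x :: "'a::complex_banach_algebra_1"
  using scaleC_scaleC [of c "- 1" x] scaleC_scaleC [of "- 1" c x] by simp

lemma scaleC_diff_right: "c *\<^sub>C (x - y) = c *\<^sub>C x - c *\<^sub>C y"
  for x :: "'a::complex_banach_algebra_1"
  using scaleC_add_right [of c x "- y"] by simp

lemma scaleC_minus_left [simp]: "(- c) *\<^sub>C x = - (c *\<^sub>C x)"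
  for x :: "'a::complex_banach_algebra_1"
  using scaleC_scaleC [of "- 1" c x] by simp

lemma scaleC_scaleR: "c *\<^sub>C (r *\<^sub>R x) = r *\<^sub>R (c *\<^sub>C x)"
  for x :: "'a::complex_banach_algebra_1"
  by (simp add: scaleC_scaleC mult.commute flip: scaleC_of_real)

context
  fixes x y :: "'a::unital_cstar_algebra"
begin

lemma star_scaleR: "star (r *\<^sub>R x) = r *\<^sub>R star x"
  by (metis complex_cnj_complex_of_real scaleC_of_real star_scaleC)

lemma star_minus: "star (- x) = - star x"
  using star_scaleR [of "- 1"] by simp

lemma star_one: "star 1 = (1::'a)"
  by (metis mult_1 mult_1_right star_mult star_star)

end

lemma star_diff: "star (x - y) = star x - star y" for x y :: "'a::unital_cstar_algebra"
  using star_add [of x "- y"] by (simp add: star_minus)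

lemmas star_simps = star_add star_diff star_minus star_mult star_star star_one
  star_scaleR star_scaleC

lemma star_power: "star (x ^ n) = star x ^ n" for x :: "'a::unital_cstar_algebra"
  by (induction n) (simp_all add: star_one star_mult power_commutes)

lemma norm_star: "norm (star x) = norm x" for x :: "'a::unital_cstar_algebra"
proof -
  have le: "norm y \<le> norm (star y)" for y :: 'a
  proof (cases "y = 0")
    case False
    have "norm y * norm y \<le> norm (star y) * norm y"
      using cstar_identity [of y] norm_mult_ineq [of "star y" y] by (simp add: power2_eq_square)
    then show ?thesis using False by simp
  qed simp
  show ?thesis using le [of x] le [of "star x"] by (simp add: star_star)
qed

lemma bounded_linear_star: "bounded_linear (star :: 'a::unital_cstar_algebra \<Rightarrow> 'a)"
  by (rule bounded_linear_intro [where K = 1]) (simp_all add: star_simps norm_star)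

lemma star_sqrt_one_minus:
  fixes w :: "'a::unital_cstar_algebra"
  assumes "norm w \<le> 1" and "star w = w"
  shows "star (sqrt_one_minus w) = sqrt_one_minus w"
  using bounded_linear.suminf
    [OF bounded_linear_star summable_norm_cancel [OF summable_sqrt_series [OF assms(1)]]]
  by (simp add: sqrt_one_minus_def star_scaleR star_power assms(2))

lemma norm_square_selfadjoint:
  fixes h :: "'a::unital_cstar_algebra"
  assumes "star h = h"
  shows "norm (h * h) = (norm h)\<^sup>2"
  using cstar_identity [of h] assms by simp

lemma cartesian_decomposition:
  fixes x :: "'a::unital_cstar_algebra"
  obtains h k where "star h = h" "star k = k" "x = h + \<i> *\<^sub>C k" "star x = h - \<i> *\<^sub>C k"
    "norm h \<le> norm x" "norm k \<le> norm x"
proof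
  let ?h = "(1/2) *\<^sub>R (x + star x)" and ?k = "(- 1/2) *\<^sub>R (\<i> *\<^sub>C (x - star x))"
  have ik: "\<i> *\<^sub>C ?k = (1/2) *\<^sub>R (x - star x)"
    unfolding scaleC_scaleR scaleC_scaleC by (simp add: scaleR_diff_right)
  show "star ?h = ?h" "star ?k = ?k"
    by (simp_all add: star_simps scaleC_diff_right algebra_simps)
  show "x = ?h + \<i> *\<^sub>C ?k" "star x = ?h - \<i> *\<^sub>C ?k"
    unfolding ik by (simp_all add: algebra_simps flip: scaleR_add_left)
  show "norm ?h \<le> norm x" "norm ?k \<le> norm x"
    using norm_triangle_ineq [of x "star x"] norm_triangle_ineq4 [of x "star x"]
    by (simp_all add: norm_star norm_scaleC)
qed

section \<open>The cone of nonnegative elements\<close>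

text \<open>
  Nonnegativity in terms of the norm. For self-adjoint \<open>h\<close> the condition says that the spectrum
  of \<open>h\<close> lies in \<open>[0, 2t]\<close>; the formulation avoids the spectrum, is visibly stable under sums
  and is exactly what makes the series for the square root converge.
\<close>

definition nonneg :: "'a::unital_cstar_algebra \<Rightarrow> bool" where
  "nonneg h \<longleftrightarrow> star h = h \<and> (\<exists>t\<ge>0. norm (t *\<^sub>R 1 - h) \<le> t)"

lemma nonneg_selfadjoint: "nonneg h \<Longrightarrow> star h = h"
  by (simp add: nonneg_def)

lemma nonneg_add:
  assumes "nonneg h" "nonneg k"
  shows "nonneg (h + k)"
proof -
  obtain t s where "t \<ge> 0" "norm (t *\<^sub>R 1 - h) \<le> t" "s \<ge> 0" "norm (s *\<^sub>R 1 - k) \<le> s"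
    using assms by (auto simp: nonneg_def)
  moreover have "(t + s) *\<^sub>R 1 - (h + k) = (t *\<^sub>R 1 - h) + (s *\<^sub>R 1 - k)"
    by (simp add: algebra_simps)
  ultimately have "norm ((t + s) *\<^sub>R 1 - (h + k)) \<le> t + s"
    using norm_triangle_mono by metis
  then show ?thesis
    using assms \<open>t \<ge> 0\<close> \<open>s \<ge> 0\<close> unfolding nonneg_def by (metis add_nonneg_nonneg star_add)
qed

lemma nonneg_scaleR:
  assumes "nonneg h" "r \<ge> 0"
  shows "nonneg (r *\<^sub>R h)"
proof -
  obtain t where t: "t \<ge> 0" "norm (t *\<^sub>R 1 - h) \<le> t"
    using assms by (auto simp: nonneg_def)
  have "(r * t) *\<^sub>R 1 - r *\<^sub>R h = r *\<^sub>R (t *\<^sub>R 1 - h)"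
    by (simp add: algebra_simps)
  then have "norm ((r * t) *\<^sub>R 1 - r *\<^sub>R h) \<le> r * t"
    using t assms(2) by (simp add: mult_left_mono)
  then show ?thesis
    using assms t unfolding nonneg_def by (metis mult_nonneg_nonneg star_scaleR)
qed

lemma nonneg_of_norm_le:
  assumes "star h = h" "norm h \<le> t"
  shows "nonneg (t *\<^sub>R 1 - h)"
proof -
  have "0 \<le> t" using norm_ge_zero assms(2) by (rule order_trans)
  then show ?thesis
    unfolding nonneg_def using assms by (intro conjI exI [of _ t]) (simp_all add: star_simps)
qed

text \<open>
  If \<open>k\<^sup>2 + l\<^sup>2 = S\<close> then \<open>u = l + ik\<close> satisfies \<open>u\<^sup>*u = S\<close>, hence \<open>\<parallel>u\<parallel>\<^sup>2 = S\<close>, and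
  \<open>2(l\<^sup>2 - k\<^sup>2) = u\<^sup>2 + (u\<^sup>*)\<^sup>2\<close>. This is the identity \<open>cos 2\<theta> = cos\<^sup>2 \<theta> - sin\<^sup>2 \<theta>\<close> for
  commuting self-adjoint elements.
\<close>

lemma norm_diff_commuting_squares_le:
  fixes k l :: "'a::unital_cstar_algebra"
  assumes k: "star k = k" and l: "star l = l" and comm: "k * l = l * k"
    and sum: "k * k + l * l = S *\<^sub>R 1" and "S \<ge> 0"
  shows "norm (l * l - k * k) \<le> S"
proof -
  define u where "u = l + \<i> *\<^sub>C k"
  have u: "star u = l - \<i> *\<^sub>C k"
    by (simp add: u_def star_simps k l)
  have "star u * u = S *\<^sub>R 1"
    unfolding sum [symmetric] u unfolding u_def
    by (simp add: algebra_simps mult_scaleC_left mult_scaleC_right scaleC_scaleC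
        scaleC_diff_right comm)
  then have nu: "(norm u)\<^sup>2 = S"
    using cstar_identity [of u] \<open>S \<ge> 0\<close> by simp
  have "u * u + star u * star u = 2 *\<^sub>R (l * l - k * k)"
    unfolding u unfolding u_def
    by (simp add: algebra_simps mult_scaleC_left mult_scaleC_right scaleC_scaleC
        scaleC_diff_right scaleC_add_right comm scaleR_2)
  then have "2 * norm (l * l - k * k) = norm (u * u + star u * star u)"
    by simp
  also have "\<dots> \<le> norm u * norm u + norm (star u) * norm (star u)"
    by (intro norm_triangle_le add_mono norm_mult_ineq)
  finally show ?thesis
    using nu by (simp add: norm_star power2_eq_square)
qed

text \<open>
  After normalising \<open>h\<close> to \<open>g\<close> with \<open>norm g = 1\<close>, take \<open>s = \<surd>(1 - g\<^sup>2)\<close>; then \<open>\<parallel>1 - 2g\<^sup>2\<parallel> = \<parallel>s\<^sup>2 - g\<^sup>2\<parallel> \<le> 1\<close>.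
\<close>

lemma nonneg_square:
  fixes h :: "'a::unital_cstar_algebra"
  assumes h: "star h = h"
  shows "nonneg (h * h)"
proof (cases "h = 0")
  case True
  then show ?thesis
    using star_minus [of "0::'a"] h by (auto simp: nonneg_def intro!: exI [of _ 0])
next
  case False
  define g where "g = (1 / norm h) *\<^sub>R h"
  define s where "s = sqrt_one_minus (g * g)"
  have g: "star g = g" "norm g = 1"
    using False by (simp_all add: g_def star_simps h)
  then have ng: "norm (g * g) \<le> 1"
    by (simp add: norm_square_selfadjoint)
  have sg: "star (g * g) = g * g"
    by (simp add: star_simps g)
  have "norm (s * s - g * g) \<le> 1"
  proof (rule norm_diff_commuting_squares_le)
    show "star g = g" "star s = s"
      using star_sqrt_one_minus [OF ng sg] by (simp_all add: g s_def)
    show "g * s = s * g"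
      unfolding s_def by (rule sqrt_one_minus_commute [OF ng]) (simp add: mult.assoc)
    show "g * g + s * s = 1 *\<^sub>R 1"
      using sqrt_one_minus_squared [OF ng] by (simp add: s_def)
  qed simp
  then have "norm (1 - 2 *\<^sub>R (g * g)) \<le> 1"
    using sqrt_one_minus_squared [OF ng] by (simp add: s_def scaleR_2 algebra_simps)
  then have "nonneg (2 *\<^sub>R (g * g))"
    unfolding nonneg_def by (auto simp: star_simps g intro!: exI [of _ 1])
  from nonneg_scaleR [OF this, of "(norm h)\<^sup>2 / 2"] show ?thesis
    using False by (simp add: g_def power2_eq_square)
qed

lemma nonneg_sqrt:
  fixes p :: "'a::unital_cstar_algebra"
  assumes "nonneg p"
  obtains s where "nonneg s" "s * s = p" "\<And>z. z * p = p * z \<Longrightarrow> z * s = s * z"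
proof -
  obtain t where t: "t \<ge> 0" "norm (t *\<^sub>R 1 - p) \<le> t"
    using assms by (auto simp: nonneg_def)
  show thesis
  proof (cases "t = 0")
    case True
    then have "p = 0" using t by simp
    then show thesis using that [of 0] assms by simp
  next
    case False
    define w where "w = 1 - (1 / t) *\<^sub>R p"
    have p: "t *\<^sub>R (1 - w) = p"
      using False by (simp add: w_def)
    have "w = (1 / t) *\<^sub>R (t *\<^sub>R 1 - p)"
      using False by (simp add: w_def algebra_simps)
    then have w: "norm w \<le> 1"
      using t False by (simp add: divide_le_eq)
    have sw: "star w = w"
      using nonneg_selfadjoint [OF assms] by (simp add: w_def star_simps)
    let ?s = "sqrt t *\<^sub>R sqrt_one_minus w"
    show thesis
    proof
      have "nonneg (sqrt_one_minus w)"
        using norm_one_minus_sqrt_one_minus [OF w] star_sqrt_one_minus [OF w sw]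
        unfolding nonneg_def by (auto intro!: exI [of _ 1])
      then show "nonneg ?s" using t by (intro nonneg_scaleR) auto
      show "?s * ?s = p"
        using t by (simp add: sqrt_one_minus_squared [OF w] p)
      show "z * ?s = ?s * z" if "z * p = p * z" for z
      proof -
        have "z * w = w * z"
          using that by (simp add: w_def algebra_simps)
        then show ?thesis
          using sqrt_one_minus_commute [OF w] by simp
      qed
    qed
  qed
qed

text \<open>
  Order bounds are norm bounds: with \<open>S - p = k\<^sup>2\<close> and \<open>S + p = l\<^sup>2\<close> the roots commute and
  \<open>l\<^sup>2 - k\<^sup>2 = 2p\<close>, \<open>k\<^sup>2 + l\<^sup>2 = 2S\<close>.
\<close>

lemma norm_le_of_nonneg:
  fixes p :: "'a::unital_cstar_algebra"
  assumes "nonneg (S *\<^sub>R 1 - p)" "nonneg (S *\<^sub>R 1 + p)" "S \<ge> 0"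
  shows "norm p \<le> S"
proof -
  obtain k where k: "nonneg k" "k * k = S *\<^sub>R 1 - p"
    "\<And>z. z * (S *\<^sub>R 1 - p) = (S *\<^sub>R 1 - p) * z \<Longrightarrow> z * k = k * z"
    using nonneg_sqrt [OF assms(1)] by metis
  obtain l where l: "nonneg l" "l * l = S *\<^sub>R 1 + p"
    "\<And>z. z * (S *\<^sub>R 1 + p) = (S *\<^sub>R 1 + p) * z \<Longrightarrow> z * l = l * z"
    using nonneg_sqrt [OF assms(2)] by metis
  have "(S *\<^sub>R 1 + p) * k = k * (S *\<^sub>R 1 + p)"
    by (rule k(3)) (simp add: algebra_simps)
  then have "k * l = l * k"
    by (intro l(3)) simp
  moreover have "k * k + l * l = (2 * S) *\<^sub>R 1"
    unfolding k l mult_2 scaleR_add_left by simp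
  ultimately have "norm (l * l - k * k) \<le> 2 * S"
    using assms(3)
    by (intro norm_diff_commuting_squares_le nonneg_selfadjoint k(1) l(1)) simp_all
  moreover have "l * l - k * k = 2 *\<^sub>R p"
    by (simp add: k l scaleR_2)
  ultimately show ?thesis by simp
qed

section \<open>Positivity of elements of the form star x * x\<close>

text \<open>
  Put \<open>p = -y\<^sup>*y\<close> and \<open>N = \<parallel>p\<parallel>\<close>. Writing \<open>y = h + ik\<close> gives \<open>yy\<^sup>* = 2h\<^sup>2 + 2k\<^sup>2 + p\<close>, so
  \<open>yy\<^sup>*\<close> is nonnegative as well and \<open>\<parallel>T - yy\<^sup>*\<parallel> \<le> T\<close> for some \<open>T > 0\<close>. Sandwiching between
  \<open>y\<^sup>*\<close> and \<open>y\<close> yields \<open>\<parallel>Tp + p\<^sup>2\<parallel> \<le> T N\<close>. Spectral theory would give \<open>T N + N\<^sup>2\<close> for the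
  left side, hence \<open>N = 0\<close>; comparing \<open>p\<^sup>2\<close> with its tangent \<open>2Np - N\<^sup>2\<close> does this directly.
\<close>

lemma eq_zero_of_nonneg_minus_star_mult_self:
  fixes y :: "'a::unital_cstar_algebra"
  assumes "nonneg (- (star y * y))"
  shows "y = 0"
proof -
  define p where "p = - (star y * y)"
  define N where "N = norm p"
  have p: "nonneg p" "star p = p"
    using assms nonneg_selfadjoint [OF assms] by (simp_all add: p_def)
  have N: "N = (norm y)\<^sup>2"
    by (simp add: N_def p_def cstar_identity)
  obtain h k where hk: "star h = h" "star k = k" "y = h + \<i> *\<^sub>C k" "star y = h - \<i> *\<^sub>C k"
    using cartesian_decomposition [of y] by metis
  have "star y * y + y * star y = 2 *\<^sub>R (h * h + k * k)"
    unfolding hk(4) unfolding hk(3)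
    by (simp add: hk(1,2) algebra_simps mult_scaleC_left mult_scaleC_right scaleC_scaleC
        scaleC_diff_right scaleC_add_right scaleR_2)
  then have "y * star y = 2 *\<^sub>R (h * h + k * k) + p"
    by (simp add: p_def algebra_simps)
  then have "nonneg (y * star y)"
    using nonneg_add [OF nonneg_scaleR [OF nonneg_add [OF nonneg_square nonneg_square], of h k 2] p(1)]
    by (simp add: hk(1,2))
  then obtain t where t: "t \<ge> 0" "norm (t *\<^sub>R 1 - y * star y) \<le> t"
    by (auto simp: nonneg_def)
  define T where "T = t + 1"
  have T: "T > 0" "norm (T *\<^sub>R 1 - y * star y) \<le> T"
  proof -
    have eq: "T *\<^sub>R 1 - y * star y = (t *\<^sub>R 1 - y * star y) + 1"
      by (simp add: T_def scaleR_add_left)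
    show "norm (T *\<^sub>R 1 - y * star y) \<le> T"
      unfolding eq using norm_triangle_ineq [of "t *\<^sub>R 1 - y * star y" 1] t by (simp add: T_def)
  qed (use t in \<open>simp add: T_def\<close>)
  \<comment> \<open>The sandwich estimate in the normalised form \<open>\<parallel>p + e p\<^sup>2\<parallel> \<le> N\<close> with \<open>e = 1/T\<close>.\<close>
  define e where "e = 1 / T"
  have e: "e > 0" "e * T = 1"
    using T by (simp_all add: e_def)
  have "star y * (T *\<^sub>R 1 - y * star y) * y = - (T *\<^sub>R p + p * p)"
    by (simp add: p_def algebra_simps)
  then have "norm (T *\<^sub>R p + p * p) = norm (star y * (T *\<^sub>R 1 - y * star y) * y)"
    by (metis norm_minus_cancel)
  also have "\<dots> \<le> norm (star y) * norm (T *\<^sub>R 1 - y * star y) * norm y"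
    by (meson norm_mult_ineq mult_right_mono norm_ge_zero order_trans)
  also have "\<dots> \<le> T * N"
    using mult_left_mono [OF T(2), of "norm y * norm y"]
    by (simp add: norm_star N power2_eq_square algebra_simps)
  finally have "norm (e *\<^sub>R (T *\<^sub>R p + p * p)) \<le> e * (T * N)"
    using e by (simp add: mult_left_mono)
  then have le: "norm (p + e *\<^sub>R (p * p)) \<le> N"
    using e by (simp add: scaleR_add_right flip: mult.assoc)
  \<comment> \<open>Adding \<open>e (p - N)\<^sup>2 \<ge> 0\<close> removes the quadratic term.\<close>
  have "nonneg ((N *\<^sub>R 1 - (p + e *\<^sub>R (p * p))) + e *\<^sub>R ((p - N *\<^sub>R 1) * (p - N *\<^sub>R 1)))"
    using e by (intro nonneg_add nonneg_scaleR nonneg_square nonneg_of_norm_le le)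
               (simp_all add: star_simps p)
  moreover have "(N *\<^sub>R 1 - (p + e *\<^sub>R (p * p))) + e *\<^sub>R ((p - N *\<^sub>R 1) * (p - N *\<^sub>R 1)) =
      (N + e * N * N) *\<^sub>R 1 - (1 + 2 * e * N) *\<^sub>R p"
    by (simp add: algebra_simps flip: scaleR_2)
  ultimately have "nonneg ((N + e * N * N) *\<^sub>R 1 - (1 + 2 * e * N) *\<^sub>R p)"
    by simp
  moreover have "nonneg ((N + e * N * N) *\<^sub>R 1 + (1 + 2 * e * N) *\<^sub>R p)"
    using e by (intro nonneg_add nonneg_scaleR p) (auto simp: N_def nonneg_def star_simps intro!: exI [of _ 1])
  ultimately have "norm ((1 + 2 * e * N) *\<^sub>R p) \<le> N + e * N * N"
    using e by (intro norm_le_of_nonneg) (auto simp: N_def)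
  then have "(1 + 2 * e * N) * N \<le> N + e * N * N"
    using e by (simp add: N_def)
  then have "e * (N * N) \<le> 0"
    by (simp add: algebra_simps)
  then have "N * N \<le> 0"
    using e by (simp add: mult_le_0_iff)
  then have "N = 0"
    using not_real_square_gt_zero by (metis not_less)
  then show ?thesis
    by (simp add: N)
qed

text \<open>
  Here \<open>c = \<surd>(b\<^sup>2)\<close> is the absolute value of \<open>b = x\<^sup>*x\<close> and \<open>e = c - b\<close> is twice its negative
  part. Since \<open>(xe)\<^sup>*(xe) = ebe = -ce\<^sup>2\<close> and \<open>ce\<^sup>2\<close> is a square, the preceding lemma gives
  \<open>xe = 0\<close>, and then \<open>e = 0\<close>, that is \<open>b = c\<close>.
\<close>

theorem nonneg_star_mult_self: "nonneg (star x * x)" for x :: "'a::unital_cstar_algebra"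
proof -
  define b where "b = star x * x"
  have b: "star b = b"
    by (simp add: b_def star_simps)
  obtain c where c: "nonneg c" "c * c = b * b" "\<And>z. z * (b * b) = b * b * z \<Longrightarrow> z * c = c * z"
    using nonneg_sqrt [OF nonneg_square [OF b]] by metis
  obtain d where d: "nonneg d" "d * d = c" "\<And>z. z * c = c * z \<Longrightarrow> z * d = d * z"
    using nonneg_sqrt [OF c(1)] by metis
  have bc: "b * c = c * b"
    by (rule c(3)) (simp add: mult.assoc)
  define e where "e = c - b"
  have e: "star e = e"
    using nonneg_selfadjoint [OF c(1)] by (simp add: e_def star_simps b)
  have ec: "e * c = c * e"
    by (simp add: e_def algebra_simps bc)
  have eb: "e * b = - (c * e)"
    by (simp add: e_def algebra_simps c(2) bc)
  have ed: "e * d = d * e"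
    by (rule d(3) [OF ec])
  have "star (x * e) * (x * e) = e * b * e"
    by (simp add: star_simps e b_def mult.assoc)
  also have "\<dots> = - (c * e * e)"
    by (simp add: eb)
  finally have y: "star (x * e) * (x * e) = - (c * e * e)" .
  have "c * e * e = (d * e) * (d * e)"
    by (metis d(2) ed mult.assoc)
  moreover have "star (d * e) = d * e"
    using nonneg_selfadjoint [OF d(1)] by (simp add: star_simps e ed)
  ultimately have "nonneg (- (star (x * e) * (x * e)))"
    using nonneg_square [of "d * e"] by (simp add: y)
  then have "x * e = 0"
    by (rule eq_zero_of_nonneg_minus_star_mult_self)
  then have be: "b * e = 0"
    by (simp add: b_def mult.assoc)
  then have "e * b = 0"
    by (metis e b star_mult star_scaleR scaleR_zero_left)
  then have "c * e = 0"
    using eb by simp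
  then have "e * e = 0"
    using be by (simp add: e_def left_diff_distrib)
  then have "norm e = 0"
    using norm_square_selfadjoint [OF e] by simp
  then have "b = c"
    by (simp add: e_def)
  then show ?thesis
    using c(1) by (simp add: b_def)
qed

section \<open>Positive invertible elements are bounded below\<close>

lemma nonneg_one: "nonneg (1 :: 'a::unital_cstar_algebra)"
  using nonneg_square [of "1::'a"] by (simp add: star_one)

text \<open>
  With \<open>p = k\<^sup>2\<close>, \<open>l = k\<^sup>-\<^sup>1\<close> and \<open>N = \<parallel>l\<^sup>2\<parallel>\<close>, conjugating \<open>N - l\<^sup>2 \<ge> 0\<close> by \<open>k\<close> gives
  \<open>N p - 1 \<ge> 0\<close>.
\<close>

lemma nonneg_invertible_bounded_below:
  fixes p :: "'a::unital_cstar_algebra"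
  assumes p: "nonneg p" and inv: "alg_invertible p"
  obtains \<delta> where "\<delta> > 0" "nonneg (p - \<delta> *\<^sub>R 1)"
proof -
  obtain k where k: "nonneg k" "k * k = p"
    using nonneg_sqrt [OF p] by metis
  obtain r where r: "p * r = 1" "r * p = 1"
    using inv by (auto simp: alg_invertible_def)
  define l where "l = k * r"
  have sk: "star k = k" by (rule nonneg_selfadjoint [OF k(1)])
  have kl: "k * l = 1"
    by (simp add: l_def k(2) r flip: mult.assoc)
  have "(r * k) * k = 1"
    by (simp add: k(2) r mult.assoc)
  then have lk: "l * k = 1"
    by (metis kl mult.assoc mult_1 mult_1_right)
  have "star l * k = 1"
    by (metis kl sk star_mult star_one)
  then have sl: "star l = l"
    by (metis kl mult.assoc mult_1 mult_1_right)
  define N where "N = norm (l * l)"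
  have "l \<noteq> 0" using kl by auto
  then have N: "N > 0"
    by (simp add: N_def norm_square_selfadjoint [OF sl])
  obtain m where m: "nonneg m" "m * m = N *\<^sub>R 1 - l * l"
    using nonneg_sqrt [OF nonneg_of_norm_le [of "l * l" N]] sl by (metis N_def order_refl star_mult)
  have "star (m * k) * (m * k) = k * (N *\<^sub>R 1 - l * l) * k"
    by (simp add: star_mult nonneg_selfadjoint [OF m(1)] sk mult.assoc flip: m(2))
  also have "\<dots> = N *\<^sub>R p - (k * l) * (l * k)"
    by (simp add: algebra_simps k(2))
  finally have "nonneg (N *\<^sub>R p - 1)"
    using nonneg_star_mult_self [of "m * k"] by (simp add: kl lk)
  from nonneg_scaleR [OF this, of "1 / N"] have "nonneg (p - (1 / N) *\<^sub>R 1)"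
    using N by (simp add: scaleR_diff_right)
  with N show thesis by (intro that) auto
qed

text \<open>
  A self-adjoint element of norm \<open>1\<close> has \<open>1\<close> or \<open>-1\<close> in its spectrum: otherwise \<open>1 - h\<^sup>2\<close> would
  be nonnegative and invertible, hence at least some \<open>d > 0\<close>, and \<open>h\<^sup>2 \<le> 1 - d\<close> bounds the norm.
\<close>

lemma norm_less_one_of_invertible:
  fixes h :: "'a::unital_cstar_algebra"
  assumes h: "star h = h" "norm h \<le> 1" and inv: "alg_invertible (1 - h)" "alg_invertible (1 + h)"
  shows "norm h < 1"
proof -
  obtain r s where r: "(1 - h) * r = 1" "r * (1 - h) = 1" and s: "(1 + h) * s = 1" "s * (1 + h) = 1"
    using inv by (auto simp: alg_invertible_def)
  have "(1 - h) * (1 + h) * (s * r) = 1" "(s * r) * ((1 - h) * (1 + h)) = 1"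
    by (metis r s mult.assoc mult_1)+
  moreover have "(1 - h) * (1 + h) = 1 - h * h"
    by (simp add: algebra_simps)
  ultimately have "alg_invertible (1 - h * h)"
    by (auto simp: alg_invertible_def)
  moreover have "nonneg (1 - h * h)"
    using nonneg_of_norm_le [of "h * h" 1] h
    by (simp add: star_simps norm_square_selfadjoint power_le_one)
  ultimately obtain d where d: "d > 0" "nonneg (1 - h * h - d *\<^sub>R 1)"
    using nonneg_invertible_bounded_below by metis
  show ?thesis
  proof (rule ccontr)
    assume "\<not> norm h < 1"
    then have n: "norm h = 1" using h by simp
    define S where "S = max 0 (1 - d)"
    have "nonneg ((1 - h * h - d *\<^sub>R 1) + (S - (1 - d)) *\<^sub>R 1)"
      by (intro nonneg_add d nonneg_scaleR nonneg_one) (simp add: S_def)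
    then have "nonneg (S *\<^sub>R 1 - h * h)"
      by (simp add: algebra_simps)
    moreover have "nonneg (S *\<^sub>R 1 + h * h)"
      by (intro nonneg_add nonneg_scaleR nonneg_one nonneg_square h) (simp add: S_def)
    ultimately have "norm (h * h) \<le> S"
      by (rule norm_le_of_nonneg) (simp add: S_def)
    then show False
      using d n by (simp add: norm_square_selfadjoint [OF h(1)] S_def)
  qed
qed

lemma alg_invertible_scaleR:
  fixes u :: "'a::real_algebra_1"
  assumes "alg_invertible u" "c \<noteq> 0"
  shows "alg_invertible (c *\<^sub>R u)"
proof -
  obtain v where "u * v = 1" "v * u = 1"
    using assms by (auto simp: alg_invertible_def)
  then show ?thesis
    using assms(2) unfolding alg_invertible_def by (intro exI [of _ "(1 / c) *\<^sub>R v"]) simp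
qed

lemma alg_invertible_plus_scaleR_one:
  fixes a :: "'a::unital_cstar_algebra"
  assumes "positive_element a" "alg_invertible a" "s \<ge> 0"
  shows "alg_invertible (a + s *\<^sub>R 1)"
proof (cases "s = 0")
  case False
  then have "complex_of_real (- s) \<notin> spectrum a"
    using assms by (auto simp: positive_element_def)
  then show ?thesis
    unfolding spectrum_def using scaleC_of_real [of "- s" "1::'a"] by simp
qed (use assms in simp)

lemma alg_invertible_scaleR_one_minus:
  fixes a :: "'a::{real_normed_algebra_1,banach}"
  assumes "norm a < s"
  shows "alg_invertible (s *\<^sub>R 1 - a)"
proof -
  have s: "s > 0"
    using assms norm_ge_zero [of a] by linarith
  define w where "w = (1 / s) *\<^sub>R a"
  have w: "norm w < 1"
    using assms s by (simp add: w_def)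
  have sm: "summable (\<lambda>n. w ^ n)"
    using w by (rule complete_algebra_summable_geometric)
  have eq: "1 + (\<Sum>n. w ^ Suc n) = (\<Sum>n. w ^ n)"
    using suminf_split_head [OF sm] by simp
  have "(1 - w) * (\<Sum>n. w ^ n) = 1"
    using eq suminf_mult [OF sm, of w] by (simp add: algebra_simps)
  moreover have "(\<Sum>n. w ^ n) * (1 - w) = 1"
    using eq suminf_mult2 [OF sm, of w] by (simp add: algebra_simps power_commutes)
  ultimately have "alg_invertible (1 - w)"
    by (auto simp: alg_invertible_def)
  from alg_invertible_scaleR [OF this, of s] show ?thesis
    using s by (simp add: w_def scaleR_diff_right)
qed

text \<open>
  The passage from the spectral notion of positivity to \<open>nonneg\<close>. If \<open>N = \<parallel>T - a\<parallel>\<close> were at least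
  \<open>T\<close>, for \<open>T > \<parallel>a\<parallel>\<close>, then \<open>h = (T - a)/N\<close> would have norm \<open>1\<close> although \<open>1 - h = (a + (N - T))/N\<close>
  and \<open>1 + h = ((N + T) - a)/N\<close> are invertible. So \<open>N < T\<close>, and \<open>\<parallel>N - (a - (T - N))\<parallel> = N\<close> says
  that \<open>a - (T - N)\<close> is nonnegative.
\<close>

proposition positive_invertible_bounded_below:
  fixes a :: "'a::unital_cstar_algebra"
  assumes a: "positive_element a" "alg_invertible a"
  obtains \<epsilon> where "\<epsilon> > 0" "nonneg (a - \<epsilon> *\<^sub>R 1)"
proof -
  have sa: "star a = a" using a by (simp add: positive_element_def)
  define T where "T = norm a + 1"
  define N where "N = norm (T *\<^sub>R 1 - a)"
  have "N < T"
  proof (rule ccontr)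
    assume "\<not> N < T"
    then have NT: "N \<ge> T" "N > 0"
      using norm_ge_zero [of a] unfolding T_def by linarith+
    define h where "h = (1 / N) *\<^sub>R (T *\<^sub>R 1 - a)"
    have "alg_invertible ((1 / N) *\<^sub>R (a + (N - T) *\<^sub>R 1))"
      using NT a by (intro alg_invertible_scaleR alg_invertible_plus_scaleR_one) auto
    moreover have "(1 / N) *\<^sub>R (a + (N - T) *\<^sub>R 1) = 1 - h"
      using NT by (simp add: h_def algebra_simps)
    moreover have "alg_invertible ((1 / N) *\<^sub>R ((N + T) *\<^sub>R 1 - a))"
      using NT by (intro alg_invertible_scaleR alg_invertible_scaleR_one_minus) (auto simp: T_def)
    moreover have "(1 / N) *\<^sub>R ((N + T) *\<^sub>R 1 - a) = 1 + h"
      using NT by (simp add: h_def algebra_simps)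
    moreover have "norm h = 1"
      using NT by (simp add: h_def flip: N_def)
    moreover have "star h = h"
      by (simp add: h_def star_simps sa)
    ultimately show False
      using norm_less_one_of_invertible [of h] by simp
  qed
  moreover have "nonneg (a - (T - N) *\<^sub>R 1)"
    unfolding nonneg_def
    by (intro conjI exI [of _ N]) (simp_all add: star_simps sa N_def algebra_simps)
  ultimately show thesis by (intro that [of "T - N"]) auto
qed

section \<open>The Hahn--Banach theorem\<close>

text \<open>
  Subadditive and positively homogeneous functionals on a real vector space.
\<close>

definition sublinear :: "('v::real_vector \<Rightarrow> real) \<Rightarrow> bool" where
  "sublinear q \<longleftrightarrow> (\<forall>x y. q (x + y) \<le> q x + q y) \<and> (\<forall>r\<ge>0. \<forall>x. q (r *\<^sub>R x) = r * q x)"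

lemma sublinear_add: "sublinear q \<Longrightarrow> q (x + y) \<le> q x + q y"
  and sublinear_scaleR: "sublinear q \<Longrightarrow> r \<ge> 0 \<Longrightarrow> q (r *\<^sub>R x) = r * q x"
  by (simp_all add: sublinear_def)

lemma sublinear_zero: "sublinear q \<Longrightarrow> q 0 = 0"
  using sublinear_scaleR [of q 0 0] by simp

lemma sublinear_minus: "sublinear q \<Longrightarrow> - q (- x) \<le> q x"
  using sublinear_add [of q x "- x"] by (simp add: sublinear_zero)

lemma sublinearI:
  fixes q :: "'v::real_vector \<Rightarrow> real"
  assumes "q 0 = 0" and "\<And>x y. q (x + y) \<le> q x + q y"
    and le: "\<And>r x. r > 0 \<Longrightarrow> q (r *\<^sub>R x) \<le> r * q x"
  shows "sublinear q"
proof -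
  have "q (r *\<^sub>R x) = r * q x" if "r \<ge> 0" for r x
  proof (cases "r = 0")
    case False
    then have r: "r > 0" using that by simp
    have "q x \<le> (1 / r) * q (r *\<^sub>R x)"
      using le [of "1 / r" "r *\<^sub>R x"] r by simp
    then have "r * q x \<le> q (r *\<^sub>R x)"
      using r by (simp add: field_simps)
    then show ?thesis using le [OF r, of x] by simp
  qed (simp add: assms)
  then show ?thesis using assms by (simp add: sublinear_def)
qed

text \<open>
  The infimum of \<open>q (x + t y) - t q y\<close> over \<open>t \<ge> 0\<close> is again sublinear; \<open>t = 0\<close> and \<open>t = 1\<close> give
  the two bounds. The second one makes a minimal \<open>q\<close> additive.
\<close>

lemma sublinear_shift:
  fixes q :: "'v::real_vector \<Rightarrow> real"
  assumes q: "sublinear q"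
  obtains q' where "sublinear q'" "\<And>x. q' x \<le> q x" "\<And>x. q' x \<le> q (x + y) - q y"
proof -
  define F where "F x t = q (x + t *\<^sub>R y) - t * q y" for x t
  define q' where "q' x = (INF t\<in>{0..}. F x t)" for x
  have below: "- q (- x) \<le> F x t" if "t \<ge> 0" for x t
    using sublinear_add [OF q, of "x + t *\<^sub>R y" "- x"] sublinear_scaleR [OF q that, of y]
    by (simp add: F_def)
  have bdd: "bdd_below (F x ` {0..})" for x
    by (rule bdd_belowI2 [of _ "- q (- x)"]) (use below in auto)
  have low: "q' x \<le> F x t" if "t \<ge> 0" for x t
    unfolding q'_def by (rule cINF_lower [OF bdd]) (use that in simp)
  have great: "c \<le> q' x" if "\<And>t. t \<ge> 0 \<Longrightarrow> c \<le> F x t" for c x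
    unfolding q'_def by (rule cINF_greatest) (use that in auto)
  have "sublinear q'"
  proof (rule sublinearI)
    show "q' 0 = 0"
      by (simp add: q'_def F_def sublinear_scaleR [OF q])
    show "q' (x + z) \<le> q' x + q' z" for x z
    proof -
      have *: "q' (x + z) \<le> F x t + F z s" if "t \<ge> 0" "s \<ge> 0" for t s
        using low [of "t + s" "x + z"] sublinear_add [OF q, of "x + t *\<^sub>R y" "z + s *\<^sub>R y"] that
        by (simp add: F_def algebra_simps)
      have "q' (x + z) - F x t \<le> q' z" if "t \<ge> 0" for t
        using * [OF that] by (intro great) (simp add: diff_le_eq add.commute)
      then have "q' (x + z) - q' z \<le> q' x"
        by (intro great) (simp add: diff_le_eq add.commute)
      then show ?thesis by simp
    qed
    show "q' (r *\<^sub>R x) \<le> r * q' x" if r: "r > 0" for r x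
    proof -
      have "q' (r *\<^sub>R x) / r \<le> F x t" if "t \<ge> 0" for t
      proof -
        have "q' (r *\<^sub>R x) \<le> q (r *\<^sub>R (x + t *\<^sub>R y)) - r * t * q y"
          using low [of "r * t" "r *\<^sub>R x"] that r by (simp add: F_def scaleR_add_right)
        also have "\<dots> = F x t * r"
          using r by (simp add: F_def sublinear_scaleR [OF q] right_diff_distrib left_diff_distrib mult_ac)
        finally show ?thesis using r by (simp add: pos_divide_le_eq)
      qed
      then have "q' (r *\<^sub>R x) / r \<le> q' x"
        by (intro great)
      then show ?thesis using r by (simp add: pos_divide_le_eq mult.commute)
    qed
  qed
  moreover have "q' x \<le> q x" "q' x \<le> q (x + y) - q y" for x
    using low [of 0 x] low [of 1 x] by (simp_all add: F_def)
  ultimately show thesis by (rule that)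
qed

lemma exists_minimal_sublinear:
  fixes p :: "'v::real_vector \<Rightarrow> real"
  assumes p: "sublinear p"
  obtains q where "sublinear q" "q \<le> p" "\<And>q'. sublinear q' \<Longrightarrow> q' \<le> q \<Longrightarrow> q' = q"
proof -
  define A where "A = {q. sublinear q \<and> q \<le> p}"
  have "\<exists>m\<in>A. \<forall>a\<in>A. (\<lambda>u v. v \<le> u) m a \<longrightarrow> a = m"
  proof (rule predicate_Zorn)
    show "partial_order_on A (relation_of (\<lambda>u v. v \<le> u) A)"
      by (auto simp: partial_order_on_def preorder_on_def refl_on_def trans_def antisym_def
          relation_of_def)
    fix C assume C: "C \<in> Chains (relation_of (\<lambda>u v. v \<le> u) A)"
    then have CA: "C \<subseteq> A" and tot: "\<And>u v. u \<in> C \<Longrightarrow> v \<in> C \<Longrightarrow> u \<le> v \<or> v \<le> u"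
      by (auto simp: Chains_def relation_of_def)
    show "\<exists>u\<in>A. \<forall>a\<in>C. u \<le> a"
    proof (cases "C = {}")
      case True
      then show ?thesis using p by (auto simp: A_def)
    next
      case False
      define u where "u x = (INF q\<in>C. q x)" for x
      have sub: "sublinear q" and le: "q x \<le> p x" if "q \<in> C" for q x
        using CA that by (auto simp: A_def le_fun_def)
      have "- p (- x) \<le> q x" if "q \<in> C" for q x
        using sublinear_minus [OF sub [OF that], of x] le [OF that, of "- x"] by linarith
      then have bdd: "bdd_below ((\<lambda>q. q x) ` C)" for x
        by (intro bdd_belowI2 [of _ "- p (- x)"])
      have low: "u x \<le> q x" if "q \<in> C" for q x
        unfolding u_def by (rule cINF_lower [OF bdd that])
      have great: "c \<le> u x" if "\<And>q. q \<in> C \<Longrightarrow> c \<le> q x" for c x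
        unfolding u_def by (rule cINF_greatest [OF False]) (rule that)
      obtain q0 where q0: "q0 \<in> C" using False by blast
      have "sublinear u"
      proof (rule sublinearI)
        show "u 0 = 0"
          using low [OF q0, of 0] great [of 0 0] sublinear_zero [OF sub] q0
          by (metis order_antisym order_refl)
        show "u (x + y) \<le> u x + u y" for x y
        proof -
          have *: "u (x + y) \<le> q1 x + q2 y" if q: "q1 \<in> C" "q2 \<in> C" for q1 q2
          proof -
            obtain q where q': "q \<in> C" "q \<le> q1" "q \<le> q2"
              using tot [OF q] q by blast
            then show ?thesis
              using low [of q "x + y"] sublinear_add [OF sub [OF q'(1)], of x y]
                le_funD [OF q'(2), of x] le_funD [OF q'(3), of y] by linarith
          qed
          have "u (x + y) - q1 x \<le> u y" if "q1 \<in> C" for q1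
            using * [OF that] by (intro great) (simp add: diff_le_eq add.commute)
          then have "u (x + y) - u y \<le> u x"
            by (intro great) (simp add: diff_le_eq add.commute)
          then show ?thesis by simp
        qed
        show "u (r *\<^sub>R x) \<le> r * u x" if r: "r > 0" for r x
        proof -
          have "u (r *\<^sub>R x) / r \<le> q x" if "q \<in> C" for q
            using low [OF that, of "r *\<^sub>R x"] sublinear_scaleR [OF sub [OF that], of r x] r
            by (simp add: pos_divide_le_eq mult.commute)
          then have "u (r *\<^sub>R x) / r \<le> u x"
            by (rule great)
          then show ?thesis using r by (simp add: pos_divide_le_eq mult.commute)
        qed
      qed
      moreover have "u \<le> p"
        using low [OF q0] le [OF q0] by (meson le_funI order_trans)
      ultimately show ?thesis
        using low by (intro bexI [of _ u]) (auto simp: A_def intro: le_funI)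
    qed
  qed
  then obtain m where m: "m \<in> A" "\<And>a. a \<in> A \<Longrightarrow> a \<le> m \<Longrightarrow> a = m" by blast
  show thesis
  proof
    show "sublinear m" "m \<le> p" using m(1) by (auto simp: A_def)
    show "q' = m" if "sublinear q'" "q' \<le> m" for q'
      using that order_trans [OF that(2) \<open>m \<le> p\<close>] by (intro m(2)) (simp_all add: A_def)
  qed
qed

text \<open>
  A minimal sublinear functional is linear. Minimality is sought below the shift of \<open>p\<close> in direction
  \<open>y\<close>, whose value at \<open>-y\<close> is at most \<open>-p y\<close>; this forces \<open>f y = p y\<close>.
\<close>

theorem Hahn_Banach_supporting:
  fixes p :: "'v::real_vector \<Rightarrow> real"
  assumes p: "sublinear p"
  obtains f where "linear f" "\<And>x. f x \<le> p x" "f y = p y"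
proof -
  obtain p' where p': "sublinear p'" "\<And>x. p' x \<le> p x" "\<And>x. p' x \<le> p (x + y) - p y"
    using sublinear_shift [OF p] by metis
  obtain f where f: "sublinear f" "f \<le> p'" and min: "\<And>q'. sublinear q' \<Longrightarrow> q' \<le> f \<Longrightarrow> q' = f"
    using exists_minimal_sublinear [OF p'(1)] by metis
  have add: "f (x + z) = f x + f z" for x z
  proof -
    obtain q where q: "sublinear q" "\<And>x. q x \<le> f x" "\<And>x. q x \<le> f (x + z) - f z"
      using sublinear_shift [OF f(1)] by metis
    have "q = f" using q by (intro min) (auto simp: le_fun_def)
    then show ?thesis
      using q(3) [of x] sublinear_add [OF f(1), of x z] by simp
  qed
  have neg: "f (- x) = - f x" for x
    using add [of x "- x"] sublinear_zero [OF f(1)] by simp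
  have "f (r *\<^sub>R x) = r * f x" for r x
  proof (cases "r \<ge> 0")
    case False
    then show ?thesis
      using sublinear_scaleR [OF f(1), of "- r" x] neg [of "r *\<^sub>R x"] by simp
  qed (simp add: sublinear_scaleR [OF f(1)])
  then have "linear f"
    by (intro linearI) (simp_all add: add)
  moreover have fp: "f x \<le> p x" for x
    using f(2) p'(2) by (meson le_funD order_trans)
  moreover have "f y = p y"
  proof -
    have "f (- y) \<le> - p y"
      using f(2) p'(3) [of "- y"] sublinear_zero [OF p] by (simp add: le_fun_def) (metis order_trans)
    then show ?thesis using neg fp [of y] by simp
  qed
  ultimately show thesis by (rule that)
qed

section \<open>States and positive functionals\<close>

text \<open>
  A real-linear \<open>f\<close> with \<open>f \<le> norm\<close> and \<open>f 1 = 1\<close> is nonnegative on nonnegative elements, because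
  \<open>t - f h = f (t1 - h) \<le> t\<close>. It is made Hermitian (\<open>g\<close>) and then complexified (\<open>\<phi>\<close>).
\<close>

theorem exists_state:
  obtains \<phi> :: "'a::unital_cstar_algebra \<Rightarrow> complex"
  where "\<phi> \<in> topological_dual" "positive_functional \<phi>" "\<phi> 1 = 1"
proof -
  have "sublinear (norm :: 'a \<Rightarrow> real)"
    by (auto simp: sublinear_def norm_triangle_ineq)
  then obtain f :: "'a \<Rightarrow> real" where f: "linear f" "\<And>x. f x \<le> norm x" "f 1 = 1"
    using Hahn_Banach_supporting [of norm "1 :: 'a"] by (metis norm_one)
  have fpos: "0 \<le> f h" if pos: "nonneg h" for h
  proof -
    obtain t where t: "norm (t *\<^sub>R 1 - h) \<le> t"
      using pos unfolding nonneg_def by blast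
    have "f (t *\<^sub>R 1 - h) = t - f h"
      using f(3) by (simp add: linear_diff [OF f(1)] linear_scale [OF f(1)])
    then show ?thesis
      using f(2) [of "t *\<^sub>R 1 - h"] t by simp
  qed
  have fabs: "\<bar>f x\<bar> \<le> norm x" for x
    using f(2) [of x] f(2) [of "- x"] by (simp add: linear_neg [OF f(1)] abs_le_iff)
  define g where "g x = f ((1/2) *\<^sub>R (x + star x))" for x
  have g_add: "g (x + y) = g x + g y" for x y
    by (simp add: g_def star_simps algebra_simps linear_add [OF f(1)])
  have g_scale: "g (r *\<^sub>R x) = r * g x" for r x
  proof -
    have "(1/2) *\<^sub>R (r *\<^sub>R x + star (r *\<^sub>R x)) = r *\<^sub>R ((1/2) *\<^sub>R (x + star x))"
      by (simp add: star_simps algebra_simps)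
    then show ?thesis by (simp only: g_def linear_scale [OF f(1)] real_scaleR_def)
  qed
  have g_sa: "g h = f h" "g (\<i> *\<^sub>C h) = 0" if "star h = h" for h
    using that by (simp_all add: g_def star_simps linear_0 [OF f(1)] flip: scaleR_2)
  have g_bound: "\<bar>g x\<bar> \<le> norm x" for x
    using fabs [of "(1/2) *\<^sub>R (x + star x)"] norm_triangle_ineq [of x "star x"]
    by (simp add: g_def norm_star)
  define \<phi> where "\<phi> x = Complex (g x) (- g (\<i> *\<^sub>C x))" for x
  have scale: "\<phi> (c *\<^sub>C x) = c * \<phi> x" for c x
  proof -
    have "c *\<^sub>C x = Re c *\<^sub>R x + Im c *\<^sub>R (\<i> *\<^sub>C x)"
      by (metis complex_eq mult.commute scaleC_add_left scaleC_of_real scaleC_scaleC)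
    moreover from this have "\<i> *\<^sub>C c *\<^sub>C x = Re c *\<^sub>R (\<i> *\<^sub>C x) - Im c *\<^sub>R x"
      by (simp add: scaleC_add_right scaleC_scaleR scaleC_scaleC)
    moreover have "g (u - v) = g u - g v" for u v
      using g_add [of "u - v" v] by simp
    ultimately show ?thesis
      by (simp add: \<phi>_def complex_eq_iff g_add g_scale)
  qed
  have "bounded_linear \<phi>"
  proof (rule bounded_linear_intro [where K = 2])
    show "\<phi> (x + y) = \<phi> x + \<phi> y" for x y
      by (simp add: \<phi>_def complex_eq_iff g_add scaleC_add_right)
    show "\<phi> (r *\<^sub>R x) = r *\<^sub>R \<phi> x" for r x
      using scale [of "complex_of_real r" x] by (simp add: scaleC_of_real scaleR_conv_of_real)
    show "norm (\<phi> x) \<le> norm x * 2" for x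
      using cmod_le [of "\<phi> x"] g_bound [of x] g_bound [of "\<i> *\<^sub>C x"]
      by (simp add: \<phi>_def norm_scaleC)
  qed
  then have "\<phi> \<in> topological_dual"
    by (simp add: topological_dual_def scale)
  moreover have "positive_functional \<phi>"
    using fpos [OF nonneg_star_mult_self]
    by (simp add: positive_functional_def complex_nonneg_Reals_iff \<phi>_def g_sa star_mult star_star)
  moreover have "\<phi> 1 = 1"
    using f(3) by (simp add: \<phi>_def g_sa star_one complex_eq_iff)
  ultimately show thesis by (rule that)
qed

lemma topological_dual_linear:
  assumes "\<phi> \<in> topological_dual"
  shows "\<phi> (x + y) = \<phi> x + \<phi> y" "\<phi> (x - y) = \<phi> x - \<phi> y" "\<phi> (- x) = - \<phi> x"
    "\<phi> (c *\<^sub>C x) = c * \<phi> x" "\<phi> (r *\<^sub>R x) = of_real r * \<phi> x"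
proof -
  interpret bounded_linear \<phi>
    using assms by (simp add: topological_dual_def)
  show "\<phi> (x + y) = \<phi> x + \<phi> y" "\<phi> (x - y) = \<phi> x - \<phi> y" "\<phi> (- x) = - \<phi> x"
    by (rule add diff neg)+
  show "\<phi> (c *\<^sub>C x) = c * \<phi> x"
    using assms by (simp add: topological_dual_def)
  show "\<phi> (r *\<^sub>R x) = of_real r * \<phi> x"
    by (rule trans [OF scaleR scaleR_conv_of_real])
qed

lemma positive_functional_nonneg:
  assumes "positive_functional \<phi>" "nonneg q"
  shows "Re (\<phi> q) \<ge> 0" "Im (\<phi> q) = 0"
proof -
  obtain s where "nonneg s" "s * s = q"
    using nonneg_sqrt [OF assms(2)] by metis
  then have "\<phi> q \<in> \<real>\<^sub>\<ge>\<^sub>0"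
    using assms(1) unfolding positive_functional_def by (metis nonneg_selfadjoint)
  then show "Re (\<phi> q) \<ge> 0" "Im (\<phi> q) = 0"
    by (simp_all add: complex_nonneg_Reals_iff)
qed

context
  fixes \<phi> :: "'a::unital_cstar_algebra \<Rightarrow> complex"
  assumes dual: "\<phi> \<in> topological_dual" and pos: "positive_functional \<phi>"
begin

lemma positive_functional_selfadjoint:
  assumes "star h = h"
  shows "Im (\<phi> h) = 0" "\<bar>Re (\<phi> h)\<bar> \<le> Re (\<phi> 1) * norm h"
proof -
  have "nonneg (norm h *\<^sub>R 1 - h)" "nonneg (norm h *\<^sub>R 1 + h)"
    using nonneg_of_norm_le [of h "norm h"] nonneg_of_norm_le [of "- h" "norm h"] assms
    by (simp_all add: star_minus)
  note p = positive_functional_nonneg [OF pos this(1)] positive_functional_nonneg [OF pos this(2)]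
  show "Im (\<phi> h) = 0" "\<bar>Re (\<phi> h)\<bar> \<le> Re (\<phi> 1) * norm h"
    using p by (simp_all add: topological_dual_linear [OF dual] abs_le_iff mult.commute)
qed

lemma positive_functional_star: "\<phi> (star x) = cnj (\<phi> x)"
proof -
  obtain h k where hk: "star h = h" "star k = k" "x = h + \<i> *\<^sub>C k" "star x = h - \<i> *\<^sub>C k"
    using cartesian_decomposition [of x] by metis
  have "\<phi> (star x) = \<phi> h - \<i> * \<phi> k"
    by (simp add: hk(4) topological_dual_linear [OF dual])
  moreover have "\<phi> x = \<phi> h + \<i> * \<phi> k"
    by (subst hk(3)) (simp add: topological_dual_linear [OF dual])
  ultimately show ?thesis
    using positive_functional_selfadjoint(1) [OF hk(1)] positive_functional_selfadjoint(1) [OF hk(2)]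
    by (simp add: complex_eq_iff)
qed

text \<open>
  The constant \<open>2\<close>, which comes from treating the two self-adjoint parts separately, is not optimal;
  only uniform boundedness matters.
\<close>

lemma positive_functional_bound: "cmod (\<phi> x) \<le> 2 * Re (\<phi> 1) * norm x"
proof -
  obtain h k where hk: "star h = h" "star k = k" "x = h + \<i> *\<^sub>C k"
    and le: "norm h \<le> norm x" "norm k \<le> norm x"
    using cartesian_decomposition [of x] by metis
  have one: "Re (\<phi> 1) \<ge> 0"
    using positive_functional_nonneg [OF pos nonneg_one] by simp
  have b: "cmod (\<phi> h) \<le> Re (\<phi> 1) * norm x" if "star h = h" "norm h \<le> norm x" for h
  proof -
    have "cmod (\<phi> h) = \<bar>Re (\<phi> h)\<bar>"
      using positive_functional_selfadjoint(1) [OF that(1)] by (simp add: cmod_eq_Re)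
    also have "\<dots> \<le> Re (\<phi> 1) * norm h"
      by (rule positive_functional_selfadjoint(2) [OF that(1)])
    also have "\<dots> \<le> Re (\<phi> 1) * norm x"
      using that(2) one by (rule mult_left_mono)
    finally show ?thesis .
  qed
  have "\<phi> x = \<phi> h + \<i> * \<phi> k"
    by (subst hk(3)) (simp add: topological_dual_linear [OF dual])
  then have "cmod (\<phi> x) \<le> cmod (\<phi> h) + cmod (\<phi> k)"
    using norm_triangle_ineq [of "\<phi> h" "\<i> * \<phi> k"] by (simp add: norm_mult)
  then show ?thesis
    using b [OF hk(1) le(1)] b [OF hk(2) le(2)] by simp
qed

end

section \<open>Weak-* compactness of the set of a-states\<close>

lemma a_states_nonempty:
  fixes a :: "'a::unital_cstar_algebra"
  assumes "positive_element a" "alg_invertible a"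
  shows "a_states a \<noteq> {}"
proof -
  obtain e where e: "e > 0" "nonneg (a - e *\<^sub>R 1)"
    using positive_invertible_bounded_below [OF assms] by metis
  obtain \<phi> :: "'a \<Rightarrow> complex" where \<phi>: "\<phi> \<in> topological_dual" "positive_functional \<phi>" "\<phi> 1 = 1"
    using exists_state by blast
  define r where "r = Re (\<phi> a)"
  have r: "r > 0" "\<phi> a = of_real r"
    using positive_functional_nonneg [OF \<phi>(2) e(2)] e(1) \<phi>(3)
    by (simp_all add: r_def topological_dual_linear [OF \<phi>(1)] complex_eq_iff)
  define \<psi> where "\<psi> x = \<phi> x / of_real r" for x
  have "bounded_linear \<psi>"
    using \<phi>(1) unfolding \<psi>_def topological_dual_def
    by (auto intro: bounded_linear_compose [OF bounded_linear_divide])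
  then have "\<psi> \<in> topological_dual"
    by (simp add: topological_dual_def \<psi>_def topological_dual_linear [OF \<phi>(1)])
  moreover have "positive_functional \<psi>"
    using \<phi>(2) r(1) by (simp add: positive_functional_def \<psi>_def complex_nonneg_Reals_iff)
  moreover have "\<psi> a = 1"
    using r by (simp add: \<psi>_def)
  ultimately show ?thesis
    by (auto simp: a_states_def)
qed

lemma a_states_uniformly_bounded:
  fixes a :: "'a::unital_cstar_algebra"
  assumes "positive_element a" "alg_invertible a"
  obtains B where "\<And>\<phi> x. \<phi> \<in> a_states a \<Longrightarrow> cmod (\<phi> x) \<le> B * norm x"
proof -
  obtain e where e: "e > 0" "nonneg (a - e *\<^sub>R 1)"
    using positive_invertible_bounded_below [OF assms] by metis
  have "cmod (\<phi> x) \<le> (2 / e) * norm x" if "\<phi> \<in> a_states a" for \<phi> x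
  proof -
    from that have \<phi>: "\<phi> \<in> topological_dual" "positive_functional \<phi>" "\<phi> a = 1"
      by (auto simp: a_states_def)
    have "e * Re (\<phi> 1) \<le> 1"
      using positive_functional_nonneg(1) [OF \<phi>(2) e(2)] \<phi>(3) by (simp add: topological_dual_linear [OF \<phi>(1)])
    then have "2 * Re (\<phi> 1) \<le> 2 / e"
      using e by (simp add: field_simps)
    then show ?thesis
      using positive_functional_bound [OF \<phi>(1,2), of x] mult_right_mono [OF _ norm_ge_zero, of _ _ x]
      by (meson order_trans)
  qed
  then show thesis by (rule that)
qed

text \<open>
  The topology is that of pointwise convergence on the function type, i.e. the weak-* topology. The
  uniform bound places the \<open>a\<close>-states in a product of discs, where they are cut out by closed
  conditions.
\<close>

theorem compact_a_states:
  fixes a :: "'a::unital_cstar_algebra"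
  assumes "positive_element a" "alg_invertible a"
  shows "compact (a_states a)"
proof -
  obtain B where B: "\<And>\<phi> x. \<phi> \<in> a_states a \<Longrightarrow> cmod (\<phi> x) \<le> B * norm x"
    using a_states_uniformly_bounded [OF assms] by metis
  define P :: "('a \<Rightarrow> complex) set" where "P = PiE UNIV (\<lambda>x. cball 0 (B * norm x))"
  define S :: "('a \<Rightarrow> complex) set" where
    "S = {\<phi>. (\<forall>x y. \<phi> (x + y) = \<phi> x + \<phi> y) \<and> (\<forall>c x. \<phi> (c *\<^sub>C x) = c * \<phi> x) \<and>
      (\<forall>x. 0 \<le> Re (\<phi> (star x * x))) \<and> (\<forall>x. Im (\<phi> (star x * x)) = 0) \<and> \<phi> a = 1}"
  have cont: "continuous_on UNIV (\<lambda>\<phi> :: 'a \<Rightarrow> complex. \<phi> x)" for x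
    by simp
  have "closed S"
    unfolding S_def
    by (intro closed_Collect_conj closed_Collect_all closed_Collect_eq closed_Collect_le
        continuous_intros cont)
  moreover have "compact P"
    using compactin_PiE [of "\<lambda>_ :: 'a. euclidean :: complex topology" UNIV "\<lambda>x. cball 0 (B * norm x)"]
    by (simp add: P_def euclidean_product_topology)
  moreover have "a_states a = P \<inter> S"
  proof (intro set_eqI iffI)
    fix \<phi> assume "\<phi> \<in> a_states a"
    then have "\<phi> \<in> topological_dual" "positive_functional \<phi>" "\<phi> a = 1"
      by (auto simp: a_states_def)
    then show "\<phi> \<in> P \<inter> S"
      using B [OF \<open>\<phi> \<in> a_states a\<close>]
      by (auto simp: P_def S_def topological_dual_linear positive_functional_def complex_nonneg_Reals_iff)
  next
    fix \<phi> assume "\<phi> \<in> P \<inter> S"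
    then have le: "cmod (\<phi> x) \<le> norm x * B" and \<phi>: "\<phi> \<in> S" for x
      by (auto simp: P_def mult.commute PiE_iff)
    have "\<phi> (r *\<^sub>R x) = of_real r * \<phi> x" for r x
      using \<phi> by (simp add: S_def flip: scaleC_of_real)
    then have "\<phi> (r *\<^sub>R x) = r *\<^sub>R \<phi> x" for r x
      by (simp only: scaleR_conv_of_real)
    then have "bounded_linear \<phi>"
      using \<phi> by (intro bounded_linear_intro [OF _ _ le]) (simp_all add: S_def)
    then show "\<phi> \<in> a_states a"
      using \<phi> by (simp add: a_states_def topological_dual_def positive_functional_def
          complex_nonneg_Reals_iff S_def)
  qed
  ultimately show ?thesis
    by (simp add: compact_Int_closed)
qed

section \<open>Maximisers of perturbed functions on compact spaces\<close>

lemma compact_SUP_attained: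
  fixes f :: "'b::topological_space \<Rightarrow> real"
  assumes "compact K" "K \<noteq> {}" "continuous_on K f"
  obtains z where "z \<in> K" "f z = (SUP w\<in>K. f w)" "\<And>w. w \<in> K \<Longrightarrow> f w \<le> (SUP w\<in>K. f w)"
proof -
  obtain z where z: "z \<in> K" "\<And>w. w \<in> K \<Longrightarrow> f w \<le> f z"
    using continuous_attains_sup [OF assms] by blast
  then have "(SUP w\<in>K. f w) = f z"
    by (intro cSup_eq_maximum) auto
  then show thesis using z that by metis
qed

text \<open>
  A one-sided derivative of a supremum: if no perturbation \<open>f + r g + r\<^sup>2 h\<close> with \<open>r > 0\<close> lowers
  the supremum below the bound \<open>M\<close> of \<open>f\<close>, then \<open>g \<ge> 0\<close> at some point where \<open>f\<close> equals \<open>M\<close>.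
  The continuous function \<open>min (f - M) g\<close> attains its maximum, and for small \<open>r\<close> a point for the
  perturbation shows that this maximum exceeds any given \<open>-\<eta>\<close>.
\<close>

lemma compact_directional_maximizer:
  fixes f g h :: "'b::topological_space \<Rightarrow> real"
  assumes K: "compact K" "K \<noteq> {}"
    and cont: "continuous_on K f" "continuous_on K g" "continuous_on K h"
    and M: "\<And>z. z \<in> K \<Longrightarrow> f z \<le> M"
    and pert: "\<And>r. r > 0 \<Longrightarrow> \<exists>z\<in>K. M \<le> f z + r * g z + r\<^sup>2 * h z"
  obtains z where "z \<in> K" "f z = M" "g z \<ge> 0"
proof -
  obtain zg zh where max: "\<forall>z\<in>K. g z \<le> g zg" "\<forall>z\<in>K. h z \<le> h zh"
    using continuous_attains_sup [OF K cont(2)] continuous_attains_sup [OF K cont(3)] by blast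
  define D where "D = g zg"
  define C where "C = h zh"
  have D: "g z \<le> D" and C: "h z \<le> C" if "z \<in> K" for z
    using max that by (auto simp: D_def C_def)
  have "continuous_on K (\<lambda>z. min (f z - M) (g z))"
    by (intro continuous_intros cont)
  then obtain z where z: "z \<in> K" "\<And>w. w \<in> K \<Longrightarrow> min (f w - M) (g w) \<le> min (f z - M) (g z)"
    using continuous_attains_sup [OF K] by blast
  define E where "E = \<bar>C\<bar> + \<bar>D\<bar> + 1"
  have "min (f z - M) (g z) \<ge> - \<eta>" if \<eta>: "\<eta> > 0" for \<eta>
  proof -
    define r where "r = min 1 (\<eta> / E)"
    have E: "E > 0" by (simp add: E_def add_nonneg_pos)
    have r: "r > 0" "r \<le> 1" "r * E \<le> \<eta>"
      using \<eta> E by (auto simp: r_def min_def field_simps)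
    obtain w where w: "w \<in> K" "M \<le> f w + r * g w + r\<^sup>2 * h w"
      using pert [OF r(1)] by blast
    have rh: "r * h w \<le> r * \<bar>C\<bar>"
      using C [OF w(1)] r by (intro mult_left_mono) auto
    \<comment> \<open>Since \<open>f w \<le> M\<close>, the perturbation terms alone are nonnegative at \<open>w\<close>.\<close>
    have "0 \<le> r * (g w + r * h w)"
      using w(2) M [OF w(1)] by (simp add: power2_eq_square algebra_simps)
    then have "0 \<le> g w + r * h w"
      using r by (simp add: zero_le_mult_iff)
    moreover have "r * \<bar>C\<bar> \<le> r * E"
      using r by (intro mult_left_mono) (auto simp: E_def)
    ultimately have "g w \<ge> - \<eta>"
      using rh r by linarith
    moreover have "f w - M \<ge> - \<eta>"
    proof -
      have "r * h w \<le> \<bar>C\<bar>"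
        using rh mult_right_mono [OF r(2), of "\<bar>C\<bar>"] by simp
      then have "g w + r * h w \<le> E"
        using D [OF w(1)] by (simp add: E_def)
      then have "r * (g w + r * h w) \<le> r * E"
        using r by (intro mult_left_mono) auto
      then have "r * g w + r\<^sup>2 * h w \<le> \<eta>"
        using r by (simp add: power2_eq_square algebra_simps)
      then show ?thesis using w(2) by linarith
    qed
    ultimately show ?thesis using z(2) [OF w(1)] by linarith
  qed
  then have "0 \<le> min (f z - M) (g z) + \<eta>" if "\<eta> > 0" for \<eta>
    using that by (metis add.commute diff_ge_0_iff_ge diff_minus_eq_add)
  then have "0 \<le> min (f z - M) (g z)"
    by (rule field_le_epsilon)
  then show thesis
    using z(1) M [OF z(1)] by (intro that [of z]) auto
qed

section \<open>Characterisation of the two orthogonality relations\<close>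

lemma Re_of_real_mult: "Re (of_real r * z) = r * Re z"
  by simp

lemma complex_polar_Arg2pi: "z = of_real (cmod z) * exp (\<i> * of_real (Arg2pi z))"
  using Arg2pi_eq [of z] by (simp add: mult.commute)

lemma a_norm_expansion:
  fixes a :: "'a::unital_cstar_algebra"
  assumes a: "star a = a" and \<phi>: "\<phi> \<in> topological_dual" "positive_functional \<phi>"
  shows "Re (\<phi> (star (x + \<xi> *\<^sub>C y) * a * (x + \<xi> *\<^sub>C y))) =
    Re (\<phi> (star x * a * x)) + 2 * Re (\<xi> * \<phi> (star x * a * y)) +
    (cmod \<xi>)\<^sup>2 * Re (\<phi> (star y * a * y))"
proof -
  have "star (x + \<xi> *\<^sub>C y) * a * (x + \<xi> *\<^sub>C y) =
    star x * a * x + \<xi> *\<^sub>C (star x * a * y) + cnj \<xi> *\<^sub>C star (star x * a * y) +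
    (cnj \<xi> * \<xi>) *\<^sub>C (star y * a * y)"
    by (simp add: star_simps a algebra_simps mult_scaleC_left mult_scaleC_right scaleC_scaleC
        scaleC_add_right)
  then have "\<phi> (star (x + \<xi> *\<^sub>C y) * a * (x + \<xi> *\<^sub>C y)) =
    \<phi> (star x * a * x) + \<xi> * \<phi> (star x * a * y) + cnj (\<xi> * \<phi> (star x * a * y)) +
    of_real ((cmod \<xi>)\<^sup>2) * \<phi> (star y * a * y)"
    by (simp add: topological_dual_linear [OF \<phi>(1)] positive_functional_star [OF \<phi>] complex_norm_square
        mult.commute del: of_real_power)
  then show ?thesis by simp
qed

lemma cmod_square_expansion:
  "(cmod (u + \<xi> * v))\<^sup>2 = (cmod u)\<^sup>2 + 2 * Re (\<xi> * cnj u * v) + (cmod \<xi>)\<^sup>2 * (cmod v)\<^sup>2"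
proof -
  have "complex_of_real ((cmod (u + \<xi> * v))\<^sup>2) =
      of_real ((cmod u)\<^sup>2 + (cmod \<xi>)\<^sup>2 * (cmod v)\<^sup>2) + (\<xi> * cnj u * v + cnj (\<xi> * cnj u * v))"
    unfolding of_real_add of_real_mult complex_norm_square by (simp add: algebra_simps)
  then show ?thesis
    unfolding complex_add_cnj of_real_add [symmetric] of_real_eq_iff by simp
qed

lemma a_states_sandwich:
  assumes "nonneg a" "\<phi> \<in> a_states a"
  shows "Re (\<phi> (star y * a * y)) \<ge> 0" "Im (\<phi> (star y * a * y)) = 0"
proof -
  obtain s where s: "nonneg s" "s * s = a"
    using nonneg_sqrt [OF assms(1)] by metis
  have eq: "star y * a * y = star (s * y) * (s * y)"
    by (simp add: star_mult nonneg_selfadjoint [OF s(1)] mult.assoc flip: s(2))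
  show "Re (\<phi> (star y * a * y)) \<ge> 0" "Im (\<phi> (star y * a * y)) = 0"
    using assms(2) unfolding eq a_states_def
    by (auto intro: positive_functional_nonneg nonneg_star_mult_self)
qed

theorem corollary4p4:
  fixes a x y :: "'a::unital_cstar_algebra"
  assumes "positive_element a" and "alg_invertible a"
  shows "(a_numerical_radius_BJ_orthogonal a x y \<longleftrightarrow>
      (\<forall>\<theta>\<in>{0..<2 * pi}. \<exists>\<phi>\<in>a_states a.
        cmod (\<phi> (a * x)) = a_numerical_radius a x \<and>
        Re (exp (\<i> * complex_of_real \<theta>) * cnj (\<phi> (a * x)) * \<phi> (a * y)) \<ge> 0)) \<and>
    (a_BJ_orthogonal a x y \<longleftrightarrow>
      (\<forall>\<theta>\<in>{0..<2 * pi}. \<exists>\<phi>\<in>a_states a.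
        \<phi> (star x * a * x) = complex_of_real ((a_norm a x)\<^sup>2) \<and>
        Re (exp (\<i> * complex_of_real \<theta>) * \<phi> (star x * a * y)) \<ge> 0))"
proof -
  define K where "K = a_states a"
  have K: "compact K" "K \<noteq> {}"
    using compact_a_states a_states_nonempty assms by (simp_all add: K_def)
  have dual: "\<phi> \<in> topological_dual" and pos: "positive_functional \<phi>" if "\<phi> \<in> K" for \<phi>
    using that by (auto simp: K_def a_states_def)
  have cont: "continuous_on K (\<lambda>\<phi>. \<phi> z)" for z
    by (rule continuous_on_subset [OF continuous_on_product_coordinates]) simp
  have sa: "star a = a"
    using assms(1) by (simp add: positive_element_def)
  have "nonneg a"
  proof -
    obtain e where "e > 0" "nonneg (a - e *\<^sub>R 1)"
      using positive_invertible_bounded_below [OF assms] by metis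
    from nonneg_add [OF this(2) nonneg_scaleR [OF nonneg_one]] this(1) show ?thesis
      by (metis diff_add_cancel less_imp_le)
  qed
  note sandwich = a_states_sandwich [OF this, folded K_def]
  have polar: "\<exists>\<theta>\<in>{0..<2 * pi}. \<xi> = of_real (cmod \<xi>) * exp (\<i> * of_real \<theta>)" for \<xi>
    using complex_polar_Arg2pi [of \<xi>] Arg2pi [of \<xi>] by auto
  have cmod_ray: "cmod (of_real r * exp (\<i> * of_real \<theta>)) = r" if "r > 0" for r \<theta>
    using that by (simp add: norm_mult)

  let ?v = "a_numerical_radius a"
  have v: "\<exists>\<phi>\<in>K. cmod (\<phi> (a * z)) = ?v z" "\<phi> \<in> K \<Longrightarrow> cmod (\<phi> (a * z)) \<le> ?v z" for z \<phi>
    using compact_SUP_attained [OF K, of "\<lambda>\<phi>. cmod (\<phi> (a * z))"] continuous_on_norm [OF cont]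
    unfolding a_numerical_radius_def K_def by metis+
  have v_expand: "(cmod (\<phi> (a * (x + \<xi> *\<^sub>C y))))\<^sup>2 = (cmod (\<phi> (a * x)))\<^sup>2 +
      2 * Re (\<xi> * cnj (\<phi> (a * x)) * \<phi> (a * y)) + (cmod \<xi>)\<^sup>2 * (cmod (\<phi> (a * y)))\<^sup>2"
    if "\<phi> \<in> K" for \<phi> \<xi>
    using cmod_square_expansion [of "\<phi> (a * x)" \<xi> "\<phi> (a * y)"]
    by (simp add: distrib_left mult_scaleC_right topological_dual_linear [OF dual [OF that]])
  have part1: "a_numerical_radius_BJ_orthogonal a x y \<longleftrightarrow> (\<forall>\<theta>\<in>{0..<2 * pi}. \<exists>\<phi>\<in>K.
        cmod (\<phi> (a * x)) = ?v x \<and>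
        Re (exp (\<i> * complex_of_real \<theta>) * cnj (\<phi> (a * x)) * \<phi> (a * y)) \<ge> 0)"
    (is "?L \<longleftrightarrow> (\<forall>\<theta>\<in>_. ?R \<theta>)")
  proof (intro iffI ballI)
    fix \<theta> :: real
    assume L: ?L
    let ?u = "exp (\<i> * complex_of_real \<theta>)"
    \<comment> \<open>Squaring the numerical radius makes the dependence on \<open>r\<close> quadratic.\<close>
    let ?g = "\<lambda>\<phi> :: 'a \<Rightarrow> complex. 2 * Re (?u * cnj (\<phi> (a * x)) * \<phi> (a * y))"
    have v0: "?v x \<ge> 0"
      using v(1) [of x] by (metis norm_ge_zero)
    obtain \<phi> where "\<phi> \<in> K" "(cmod (\<phi> (a * x)))\<^sup>2 = (?v x)\<^sup>2" "?g \<phi> \<ge> 0"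
    proof (rule compact_directional_maximizer [OF K, where f = "\<lambda>\<phi>. (cmod (\<phi> (a * x)))\<^sup>2" and g = ?g
          and h = "\<lambda>\<phi>. (cmod (\<phi> (a * y)))\<^sup>2" and M = "(?v x)\<^sup>2"])
      show "\<exists>\<phi>\<in>K. (?v x)\<^sup>2 \<le> (cmod (\<phi> (a * x)))\<^sup>2 + r * ?g \<phi> + r\<^sup>2 * (cmod (\<phi> (a * y)))\<^sup>2"
        if r: "r > 0" for r
      proof -
        obtain \<phi> where \<phi>: "\<phi> \<in> K" "cmod (\<phi> (a * (x + (of_real r * ?u) *\<^sub>C y))) = ?v (x + (of_real r * ?u) *\<^sub>C y)"
          using v(1) by blast
        then have "?v x \<le> cmod (\<phi> (a * (x + (of_real r * ?u) *\<^sub>C y)))"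
          using L by (simp add: a_numerical_radius_BJ_orthogonal_def)
        then have "(?v x)\<^sup>2 \<le> (cmod (\<phi> (a * (x + (of_real r * ?u) *\<^sub>C y))))\<^sup>2"
          using v0 by (intro power_mono)
        then show ?thesis
          unfolding v_expand [OF \<phi>(1)] cmod_ray [OF r]
          by (intro bexI [OF _ \<phi>(1)]) (simp only: mult.assoc Re_of_real_mult mult.left_commute [of 2])
      qed
    qed (auto intro!: continuous_intros cont power_mono v(2))
    then show "?R \<theta>"
      using v0 by (intro bexI [of _ \<phi>]) (auto simp: power2_eq_iff_nonneg)
  next
    assume R: "\<forall>\<theta>\<in>{0..<2 * pi}. ?R \<theta>"
    show ?L
      unfolding a_numerical_radius_BJ_orthogonal_def
    proof
      fix \<xi>
      obtain \<theta> where \<theta>: "\<theta> \<in> {0..<2 * pi}" "\<xi> = of_real (cmod \<xi>) * exp (\<i> * of_real \<theta>)"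
        using polar by blast
      then obtain \<phi> where \<phi>: "\<phi> \<in> K" "cmod (\<phi> (a * x)) = ?v x"
        "Re (exp (\<i> * complex_of_real \<theta>) * cnj (\<phi> (a * x)) * \<phi> (a * y)) \<ge> 0"
        using R by blast
      have "Re (\<xi> * cnj (\<phi> (a * x)) * \<phi> (a * y)) =
          cmod \<xi> * Re (exp (\<i> * complex_of_real \<theta>) * cnj (\<phi> (a * x)) * \<phi> (a * y))"
        by (subst \<theta>(2)) (simp only: mult.assoc Re_of_real_mult)
      then have "(?v x)\<^sup>2 \<le> (cmod (\<phi> (a * (x + \<xi> *\<^sub>C y))))\<^sup>2"
        unfolding v_expand [OF \<phi>(1)] \<phi>(2) using \<phi>(3) by simp
      then have "?v x \<le> cmod (\<phi> (a * (x + \<xi> *\<^sub>C y)))"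
        by (rule power2_le_imp_le) simp
      then show "?v x \<le> ?v (x + \<xi> *\<^sub>C y)"
        using v(2) [OF \<phi>(1)] by (rule order_trans)
    qed
  qed

  let ?n = "a_norm a"
  have n: "\<exists>\<phi>\<in>K. sqrt (Re (\<phi> (star z * a * z))) = ?n z"
    "\<phi> \<in> K \<Longrightarrow> sqrt (Re (\<phi> (star z * a * z))) \<le> ?n z" for z \<phi>
    using compact_SUP_attained [OF K, of "\<lambda>\<phi>. sqrt (Re (\<phi> (star z * a * z)))"]
      continuous_on_real_sqrt [OF continuous_on_Re [OF cont]]
    unfolding a_norm_def K_def by metis+
  have n0: "?n z \<ge> 0" for z
    using n(1) [of z] sandwich(1) by (metis real_sqrt_ge_zero)
  have n_le: "Re (\<phi> (star z * a * z)) \<le> (?n z)\<^sup>2" if "\<phi> \<in> K" for \<phi> z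
    using n(2) [OF that] by (rule sqrt_le_D)
  note n_expand = a_norm_expansion [OF sa dual pos]
  have part2: "a_BJ_orthogonal a x y \<longleftrightarrow> (\<forall>\<theta>\<in>{0..<2 * pi}. \<exists>\<phi>\<in>K.
        \<phi> (star x * a * x) = complex_of_real ((?n x)\<^sup>2) \<and>
        Re (exp (\<i> * complex_of_real \<theta>) * \<phi> (star x * a * y)) \<ge> 0)"
    (is "?L \<longleftrightarrow> (\<forall>\<theta>\<in>_. ?R \<theta>)")
  proof (intro iffI ballI)
    fix \<theta> :: real
    assume L: ?L
    let ?u = "exp (\<i> * complex_of_real \<theta>)"
    let ?g = "\<lambda>\<phi> :: 'a \<Rightarrow> complex. 2 * Re (?u * \<phi> (star x * a * y))"
    obtain \<phi> where \<phi>: "\<phi> \<in> K" "Re (\<phi> (star x * a * x)) = (?n x)\<^sup>2" "?g \<phi> \<ge> 0"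
    proof (rule compact_directional_maximizer [OF K, where f = "\<lambda>\<phi>. Re (\<phi> (star x * a * x))" and g = ?g
          and h = "\<lambda>\<phi>. Re (\<phi> (star y * a * y))" and M = "(?n x)\<^sup>2"])
      show "\<exists>\<phi>\<in>K. (?n x)\<^sup>2 \<le> Re (\<phi> (star x * a * x)) + r * ?g \<phi> + r\<^sup>2 * Re (\<phi> (star y * a * y))"
        if r: "r > 0" for r
      proof -
        let ?z = "x + (of_real r * ?u) *\<^sub>C y"
        obtain \<phi> where \<phi>: "\<phi> \<in> K" "sqrt (Re (\<phi> (star ?z * a * ?z))) = ?n ?z"
          using n(1) by blast
        then have "(?n x)\<^sup>2 \<le> (sqrt (Re (\<phi> (star ?z * a * ?z))))\<^sup>2"
          using L n0 by (simp add: a_BJ_orthogonal_def)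
        also have "\<dots> = Re (\<phi> (star ?z * a * ?z))"
          using sandwich(1) [OF \<phi>(1)] by simp
        finally show ?thesis
          unfolding n_expand [OF \<phi>(1) \<phi>(1)] cmod_ray [OF r]
          by (intro bexI [OF _ \<phi>(1)]) (simp only: mult.assoc Re_of_real_mult mult.left_commute [of 2])
      qed
    qed (auto intro!: continuous_intros cont n_le)
    then show "?R \<theta>"
      using sandwich(2) [OF \<phi>(1)] by (intro bexI [of _ \<phi>]) (auto simp: complex_eq_iff)
  next
    assume R: "\<forall>\<theta>\<in>{0..<2 * pi}. ?R \<theta>"
    show ?L
      unfolding a_BJ_orthogonal_def
    proof
      fix \<xi>
      let ?z = "x + \<xi> *\<^sub>C y"
      obtain \<theta> where \<theta>: "\<theta> \<in> {0..<2 * pi}" "\<xi> = of_real (cmod \<xi>) * exp (\<i> * of_real \<theta>)"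
        using polar by blast
      then obtain \<phi> where \<phi>: "\<phi> \<in> K" "\<phi> (star x * a * x) = complex_of_real ((?n x)\<^sup>2)"
        "Re (exp (\<i> * complex_of_real \<theta>) * \<phi> (star x * a * y)) \<ge> 0"
        using R by blast
      have "Re (\<xi> * \<phi> (star x * a * y)) =
          cmod \<xi> * Re (exp (\<i> * complex_of_real \<theta>) * \<phi> (star x * a * y))"
        by (subst \<theta>(2)) (simp only: mult.assoc Re_of_real_mult)
      then have "(?n x)\<^sup>2 \<le> Re (\<phi> (star ?z * a * ?z))"
        unfolding n_expand [OF \<phi>(1) \<phi>(1)] \<phi>(2) using \<phi>(3) sandwich(1) [OF \<phi>(1)] by simp
      then have "?n x \<le> sqrt (Re (\<phi> (star ?z * a * ?z)))"
        by (rule real_le_rsqrt)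
      then show "?n x \<le> ?n ?z"
        using n(2) [OF \<phi>(1)] by (rule order_trans)
    qed
  qed
  show ?thesis
    using part1 part2 unfolding K_def by (rule conjI)
qed

end
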